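(* Let $p$ be an odd prime. Then there does not exist a $(4p,p,4p,4)$ relative difference set in $G=\mathbb{Z}_4\times\mathbb{Z}_p^2$ (relative to any subgroup of order $p$).
   Context: Let $G$ be a finite group of order $mn$ and $N$ a subgroup of order $n$. A $k$-subset $R$ of $G$ is an $(m,n,k,\lambda)$ relative difference set in $G$ relative to $N$ if every element $g\in G\setminus N$ has exactly $\lambda$ representations $g=r_1r_2^{-1}$ with $r_1,r_2\in R$, and no non-identity element of $N$ has such a representation. *)

theory Defs
  imports "HOL-Algebra.Elementary_Groups" "HOL-Computational_Algebra.Primes"
begin

definition relative_difference_set ::
  "('a, 'b) monoid_scheme \<Rightarrow> 'a set \<Rightarrow> nat \<Rightarrow> nat \<Rightarrow> nat \<Rightarrow> nat \<Rightarrow> 'a set \<Rightarrow> bool" where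
  "relative_difference_set G N m n k l R \<longleftrightarrow>
     group G \<and> finite (carrier G) \<and> order G = m * n \<and>
     subgroup N G \<and> card N = n \<and>
     R \<subseteq> carrier G \<and> card R = k \<and>
     (\<forall>g \<in> carrier G - N.
        card {(r1, r2). r1 \<in> R \<and> r2 \<in> R \<and> g = r1 \<otimes>\<^bsub>G\<^esub> inv\<^bsub>G\<^esub> r2} = l) \<and>
     (\<forall>g \<in> N - {\<one>\<^bsub>G\<^esub>}.
        \<not> (\<exists>r1 \<in> R. \<exists>r2 \<in> R. g = r1 \<otimes>\<^bsub>G\<^esub> inv\<^bsub>G\<^esub> r2))"

end

theory Submission
  imports Defs "HOL-Number_Theory.Residues"
begin

text \<open>
  The set \<open>R\<close> meets every coset of \<open>N\<close> once, so it is the graph of a function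
  \<open>f : \<int>\<^sub>4 \<times> \<int>\<^sub>p \<rightarrow> \<int>\<^sub>p\<close>, and a character that is nontrivial on \<open>N\<close> gives a sum
  \<open>\<Sum>x<4. \<i> ^ (j * x) * E x\<close> of squared absolute value \<open>4 * p\<close>, where
  \<open>E x = (\<Sum>t. \<zeta> ^ (f x t + c * t))\<close>. Put \<open>S = E 0 + E 2\<close> and \<open>T = E 1 + E 3\<close>, so that
  \<open>S + T\<close> and \<open>S - T\<close> have squared absolute value \<open>4 * p\<close>. Comparing \<open>j\<close> even and \<open>j\<close> odd
  modulo 2 shows that 2 divides \<open>|S|\<^sup>2\<close>, and as \<open>p\<close> is totally ramified it divides
  \<open>(S + T) * cnj (S - T)\<close>; let \<open>\<beta>\<close> be the quotient. Then \<open>|\<beta>| = 4\<close>, and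
  \<open>Re \<beta> / 4 = |S|\<^sup>2 / (2 * p) - 1\<close> is an algebraic integer all of whose conjugates lie in \<open>[-1, 1]\<close>,
  hence each is \<open>0\<close>, \<open>1\<close> or \<open>-1\<close>. The value \<open>0\<close> would make \<open>|\<beta> - cnj \<beta>|\<^sup>2 = 64\<close>, but
  \<open>\<beta> - cnj \<beta>\<close> is divisible by \<open>1 - \<zeta>\<close>. Thus for every \<open>c\<close> one of \<open>S\<close>, \<open>T\<close> vanishes.
  By Parseval the number of \<open>c\<close> with \<open>T = 0\<close> is, up to a factor 4, the sum of
  \<open>|\<zeta> ^ f 0 t + \<zeta> ^ f 2 t|\<^sup>2\<close> over \<open>t\<close>; it is divisible by \<open>p\<close>, so it is \<open>0\<close> or \<open>p\<close>. Then
  \<open>S\<close> or \<open>T\<close> vanishes for all \<open>c\<close>, which is impossible since \<open>\<zeta> ^ m + \<zeta> ^ n \<noteq> 0\<close>.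
\<close>

section \<open>Characters\<close>

definition unitary_character :: "('a, 'b) monoid_scheme \<Rightarrow> ('a \<Rightarrow> complex) \<Rightarrow> bool" where
  "unitary_character G \<chi> \<longleftrightarrow>
     (\<forall>x\<in>carrier G. \<forall>y\<in>carrier G. \<chi> (x \<otimes>\<^bsub>G\<^esub> y) = \<chi> x * \<chi> y) \<and>
     (\<forall>x\<in>carrier G. cmod (\<chi> x) = 1)"

lemma unitary_character_mult:
  "unitary_character G \<chi> \<Longrightarrow> x \<in> carrier G \<Longrightarrow> y \<in> carrier G \<Longrightarrow> \<chi> (x \<otimes>\<^bsub>G\<^esub> y) = \<chi> x * \<chi> y"
  by (simp add: unitary_character_def)

lemma unitary_character_norm:
  "unitary_character G \<chi> \<Longrightarrow> x \<in> carrier G \<Longrightarrow> cmod (\<chi> x) = 1"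
  by (simp add: unitary_character_def)

lemma (in group) unitary_character_one:
  assumes "unitary_character G \<chi>"
  shows "\<chi> \<one> = 1"
proof -
  have "\<chi> \<one> * \<chi> \<one> = \<chi> \<one>"
    using unitary_character_mult[OF assms, of \<one> \<one>] by simp
  moreover have "\<chi> \<one> \<noteq> 0"
    using unitary_character_norm[OF assms, of \<one>] by auto
  ultimately show ?thesis by simp
qed

lemma (in group) unitary_character_inv:
  assumes \<chi>: "unitary_character G \<chi>" and x: "x \<in> carrier G"
  shows "\<chi> (inv x) = cnj (\<chi> x)"
proof -
  have "\<chi> x * \<chi> (inv x) = 1"
    using unitary_character_mult[OF \<chi> x, of "inv x"] unitary_character_one[OF \<chi>] x by simp
  moreover have "\<chi> x * cnj (\<chi> x) = 1"
    using unitary_character_norm[OF \<chi> x] by (simp flip: complex_norm_square)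
  ultimately show ?thesis by (metis mult_left_cancel mult_zero_left zero_neq_one)
qed

lemma unitary_character_DirProd:
  assumes "unitary_character G \<chi>" "unitary_character H \<psi>"
  shows "unitary_character (G \<times>\<times> H) (\<lambda>(x, y). \<chi> x * \<psi> y)"
  using assms by (auto simp: unitary_character_def norm_mult)

lemma (in group) sum_unitary_character_subgroup:
  assumes \<chi>: "unitary_character G \<chi>" and N: "subgroup N G" and n: "n \<in> N" "\<chi> n \<noteq> 1"
  shows "(\<Sum>x\<in>N. \<chi> x) = 0"
proof -
  interpret N: subgroup N G by fact
  have "bij_betw (\<lambda>x. n \<otimes> x) N N"
  proof (rule bij_betw_byWitness[where f' = "\<lambda>x. inv n \<otimes> x"])
    show "\<forall>x\<in>N. inv n \<otimes> (n \<otimes> x) = x" "\<forall>x\<in>N. n \<otimes> (inv n \<otimes> x) = x"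
      using n(1) by (simp_all flip: m_assoc)
  qed (use n(1) in auto)
  then have "(\<Sum>x\<in>N. \<chi> x) = (\<Sum>x\<in>N. \<chi> (n \<otimes> x))"
    by (rule sum.reindex_bij_betw[symmetric])
  also have "\<dots> = \<chi> n * (\<Sum>x\<in>N. \<chi> x)"
    using n(1) by (simp add: unitary_character_mult[OF \<chi>] sum_distrib_left)
  finally show ?thesis using n(2) by simp
qed

lemma (in group) sum_unitary_character:
  assumes "unitary_character G \<chi>" "x \<in> carrier G" "\<chi> x \<noteq> 1"
  shows "(\<Sum>x\<in>carrier G. \<chi> x) = 0"
  using sum_unitary_character_subgroup[OF assms(1) subgroup_self assms(2,3)] .

definition unity_root :: "nat \<Rightarrow> int \<Rightarrow> complex" where
  "unity_root n m = cis (2 * pi * of_int m / of_nat n)"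

lemma unity_root_0 [simp]: "unity_root n 0 = 1"
  by (simp add: unity_root_def)

lemma unity_root_add: "unity_root n (a + b) = unity_root n a * unity_root n b"
  by (simp add: unity_root_def cis_mult add_divide_distrib distrib_left)

lemma unity_root_power: "unity_root n a ^ j = unity_root n (a * int j)"
  by (induction j) (simp_all add: unity_root_add distrib_left)

lemma cnj_unity_root [simp]: "cnj (unity_root n a) = unity_root n (- a)"
  by (simp add: unity_root_def cis_cnj)

lemma norm_unity_root [simp]: "cmod (unity_root n a) = 1"
  by (simp add: unity_root_def)

lemma unity_root_eq_1_iff:
  assumes "n > 0"
  shows "unity_root n a = 1 \<longleftrightarrow> int n dvd a"
proof
  assume "unity_root n a = 1"
  then have "cos (2 * pi * of_int a / of_nat n) = 1"
    by (simp add: unity_root_def complex_eq_iff)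
  then obtain b :: int where "2 * pi * of_int a / of_nat n = of_int b * 2 * pi"
    by (auto simp: cos_one_2pi_int)
  then have "real_of_int a = of_int (b * int n)"
    using assms by (simp add: field_simps)
  then show "int n dvd a" by (simp only: of_int_eq_iff) simp
next
  assume "int n dvd a"
  then obtain b where "a = int n * b" by blast
  then have "2 * pi * of_int a / of_nat n = 2 * pi * of_int b"
    using assms by simp
  then show "unity_root n a = 1" by (simp add: unity_root_def)
qed

lemma unity_root_cong:
  assumes "[a = b] (mod int n)"
  shows "unity_root n a = unity_root n b"
proof (cases "n = 0")
  case False
  then have "unity_root n (a - b) = 1"
    using assms by (simp add: unity_root_eq_1_iff cong_iff_dvd_diff)
  then show ?thesis using unity_root_add[of n "a - b" b] by simp
qed (use assms in \<open>simp add: cong_def\<close>)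

lemma unitary_character_unity_root:
  "unitary_character (integer_mod_group n) (\<lambda>x. unity_root n (a * x))"
proof -
  have "unity_root n (a * ((x + y) mod int n)) = unity_root n (a * x) * unity_root n (a * y)"
    for x y
    unfolding unity_root_add[symmetric] distrib_left[symmetric]
    by (intro unity_root_cong cong_scalar_left) simp
  then show ?thesis by (simp add: unitary_character_def)
qed

lemma sum_unity_root:
  assumes "n > 0"
  shows "(\<Sum>x\<in>{0..<int n}. unity_root n (a * x)) = (if int n dvd a then of_nat n else 0)"
proof (cases "int n dvd a")
  case True
  then have "unity_root n (a * x) = 1" for x
    using assms by (simp add: unity_root_eq_1_iff)
  then show ?thesis using True by simp
next
  case False
  then have "unity_root n (a * 1) \<noteq> 1" and "n \<noteq> 1"
    using assms by (auto simp: unity_root_eq_1_iff)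
  then show ?thesis
    using group.sum_unitary_character[OF group_integer_mod_group unitary_character_unity_root,
        of 1 n a] False assms by (simp add: carrier_integer_mod_group)
qed

lemma parseval_unity_root:
  assumes "n > 0" "coprime k (int n)"
  shows "(\<Sum>c\<in>{0..<int n}. (cmod (\<Sum>t\<in>{0..<int n}. u t * unity_root n (k * c * t)))\<^sup>2)
    = of_nat n * (\<Sum>t\<in>{0..<int n}. (cmod (u t))\<^sup>2)" (is "?L = ?R")
proof -
  let ?I = "{0..<int n}"
  have orthogonal: "(\<Sum>c\<in>?I. unity_root n ((k * (t - t')) * c)) = (if t' = t then of_nat n else 0)"
    if "t \<in> ?I" "t' \<in> ?I" for t t'
  proof -
    have "int n dvd k * (t - t') \<longleftrightarrow> int n dvd t - t'"
      using assms(2) by (simp add: coprime_commute coprime_dvd_mult_right_iff)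
    also have "\<dots> \<longleftrightarrow> t' = t"
      using that by (auto simp: mod_eq_dvd_iff[symmetric])
    finally show ?thesis by (simp add: sum_unity_root[OF assms(1)])
  qed
  have "of_real ?L = (\<Sum>c\<in>?I. \<Sum>t\<in>?I. \<Sum>t'\<in>?I. u t * cnj (u t') * unity_root n ((k * (t - t')) * c))"
    by (simp only: of_real_sum complex_norm_square cnj_sum sum_product)
      (simp add: algebra_simps flip: unity_root_add)
  also have "\<dots> = (\<Sum>t\<in>?I. \<Sum>t'\<in>?I. \<Sum>c\<in>?I. u t * cnj (u t') * unity_root n ((k * (t - t')) * c))"
    by (subst sum.swap) (intro sum.cong refl sum.swap)
  also have "\<dots> = (\<Sum>t\<in>?I. \<Sum>t'\<in>?I. if t' = t then of_nat n * (u t * cnj (u t')) else 0)"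
    by (intro sum.cong refl) (simp add: orthogonal flip: sum_distrib_left)
  also have "\<dots> = of_nat n * (\<Sum>t\<in>?I. u t * cnj (u t))"
    by (simp add: sum_distrib_left)
  also have "\<dots> = of_real ?R"
    by (simp only: of_real_mult of_real_of_nat_eq of_real_sum complex_norm_square)
  finally show ?thesis by (simp only: of_real_eq_iff)
qed

section \<open>Cyclotomic integers\<close>

locale odd_prime =
  fixes p :: nat
  assumes prime_p: "prime p" and odd_p: "odd p"
begin

lemma p_gt_2: "p > 2"
  using prime_p odd_p prime_ge_2_nat[of p] by (cases "p = 2") auto

lemma p_pos [simp]: "p > 0" and p_neq_0 [simp]: "p \<noteq> 0"
  using p_gt_2 by simp_all

lemma not_p_dvd_1: "\<not> int p dvd 1"
  using p_gt_2 by auto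

lemma p_dvd_mult_iff: "int p dvd a * b \<longleftrightarrow> int p dvd a \<or> int p dvd b"
  using prime_p by (simp add: prime_dvd_mult_iff)

lemma not_p_dvd_2: "\<not> int p dvd 2"
  using p_gt_2 by (auto dest: zdvd_imp_le)

lemma p_dvd_2_power_mult_iff: "int p dvd 2 ^ n * a \<longleftrightarrow> int p dvd a"
  using not_p_dvd_2 not_p_dvd_1 by (induction n) (auto simp: p_dvd_mult_iff)

lemma coprime_p: "\<not> int p dvd a \<Longrightarrow> coprime a (int p)"
  using prime_imp_coprime[of "int p" a] prime_p by (simp add: coprime_commute)

lemma coprime_2_power_p: "coprime (2 ^ n) p"
  using odd_p by (simp only: coprime_power_left_iff) simp

lemma not_p_dvd: "k \<in> {1..<int p} \<Longrightarrow> \<not> int p dvd k"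
  by (auto dest: zdvd_imp_le)

abbreviation \<zeta> :: "int \<Rightarrow> complex" where
  "\<zeta> \<equiv> unity_root p"

lemma zeta_neq_1: "\<not> int p dvd k \<Longrightarrow> \<zeta> k \<noteq> 1"
  by (simp add: unity_root_eq_1_iff)

lemma zeta_power_p [simp]: "\<zeta> k ^ p = 1"
  by (simp add: unity_root_power unity_root_eq_1_iff)

lemma zeta_add_neq_0: "\<zeta> a + \<zeta> b \<noteq> 0"
proof
  assume "\<zeta> a + \<zeta> b = 0"
  then have "\<zeta> a = - \<zeta> b" by (simp add: eq_neg_iff_add_eq_0)
  then have "1 = (- \<zeta> b) ^ p" by (metis zeta_power_p)
  then show False using odd_p by (simp add: complex_eq_iff)
qed

text \<open>
  An element of \<open>\<int>[\<zeta>]\<close> is represented by the family of its conjugates, indexed by the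
  \<open>k\<close> prime to \<open>p\<close>; values at multiples of \<open>p\<close> are irrelevant. Carrying all conjugates
  along makes the irreducibility of the cyclotomic polynomial unnecessary. In
  \<open>has_residue \<phi> s\<close> the number \<open>s\<close> is the image under \<open>\<zeta> \<mapsto> 1\<close>, which is determined by \<open>\<phi>\<close>
  only modulo \<open>p\<close>. Divisibility of \<open>\<phi>\<close> by \<open>d\<close> is expressed as integrality of \<open>\<lambda>k. \<phi> k / d\<close>.
\<close>

inductive has_residue :: "(int \<Rightarrow> complex) \<Rightarrow> int \<Rightarrow> bool" where
  zeta: "has_residue (\<lambda>k. \<zeta> (k * a)) 1"
| diff: "has_residue \<phi> s \<Longrightarrow> has_residue \<psi> t \<Longrightarrow> has_residue (\<lambda>k. \<phi> k - \<psi> k) (s - t)"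
| agree: "has_residue \<phi> s \<Longrightarrow> (\<And>k. \<not> int p dvd k \<Longrightarrow> \<psi> k = \<phi> k) \<Longrightarrow> has_residue \<psi> s"

definition cyclotomic_integer :: "(int \<Rightarrow> complex) \<Rightarrow> bool" where
  "cyclotomic_integer \<phi> \<longleftrightarrow> (\<exists>s. has_residue \<phi> s)"

lemma cyclotomic_integerI: "has_residue \<phi> s \<Longrightarrow> cyclotomic_integer \<phi>"
  by (auto simp: cyclotomic_integer_def)

lemma cyclotomic_integerE:
  assumes "cyclotomic_integer \<phi>"
  obtains s where "has_residue \<phi> s"
  using assms by (auto simp: cyclotomic_integer_def)

lemma cyclotomic_integer_cong:
  assumes "cyclotomic_integer \<phi>" "\<And>k. \<not> int p dvd k \<Longrightarrow> \<psi> k = \<phi> k"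
  shows "cyclotomic_integer \<psi>"
  using assms has_residue.agree unfolding cyclotomic_integer_def by blast

lemma has_residue_0: "has_residue (\<lambda>k. 0) 0"
  using has_residue.diff[OF has_residue.zeta has_residue.zeta, of 0 0] by simp

lemma has_residue_minus: "has_residue \<phi> s \<Longrightarrow> has_residue (\<lambda>k. - \<phi> k) (- s)"
  using has_residue.diff[OF has_residue_0] by fastforce

lemma has_residue_add:
  "has_residue \<phi> s \<Longrightarrow> has_residue \<psi> t \<Longrightarrow> has_residue (\<lambda>k. \<phi> k + \<psi> k) (s + t)"
  using has_residue.diff[of \<phi> s "\<lambda>k. - \<psi> k" "- t"] has_residue_minus[of \<psi> t] by simp

lemma has_residue_of_int: "has_residue (\<lambda>k. of_int m) m"
proof (induction m rule: int_induct[where k = 0])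
  case base
  show ?case using has_residue_0 by simp
next
  case (step1 m)
  then show ?case using has_residue_add[OF _ has_residue.zeta[of 0]] by fastforce
next
  case (step2 m)
  then show ?case using has_residue.diff[OF _ has_residue.zeta[of 0]] by fastforce
qed

lemma has_residue_mult:
  assumes "has_residue \<phi> s" "has_residue \<psi> t"
  shows "has_residue (\<lambda>k. \<phi> k * \<psi> k) (s * t)"
  using assms(1)
proof (induction rule: has_residue.induct)
  case (zeta a)
  from assms(2) show ?case
  proof (induction rule: has_residue.induct)
    case (zeta b)
    show ?case using has_residue.zeta[of "a + b"] by (simp add: unity_root_add distrib_left)
  next
    case (diff \<phi> s \<psi> t)
    show ?case using has_residue.diff[OF diff.IH] by (simp add: right_diff_distrib)
  next
    case (agree \<phi> s \<psi>)
    show ?case using agree.hyps(2) by (intro has_residue.agree[OF agree.IH]) simp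
  qed
next
  case (diff \<phi> s \<psi>' t')
  show ?case using has_residue.diff[OF diff.IH] by (simp add: left_diff_distrib)
next
  case (agree \<phi> s \<psi>')
  show ?case using agree.hyps(2) by (intro has_residue.agree[OF agree.IH]) simp
qed

lemma has_residue_power: "has_residue \<phi> s \<Longrightarrow> has_residue (\<lambda>k. \<phi> k ^ n) (s ^ n)"
  using has_residue_of_int[of 1] by (induction n) (simp_all add: has_residue_mult)

lemma has_residue_sum:
  assumes "\<And>i. i \<in> A \<Longrightarrow> has_residue (\<phi> i) (s i)"
  shows "has_residue (\<lambda>k. \<Sum>i\<in>A. \<phi> i k) (\<Sum>i\<in>A. s i)"
  using assms
  by (induction A rule: infinite_finite_induct) (simp_all add: has_residue_0 has_residue_add)

lemma has_residue_conjugate: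
  assumes "has_residue \<phi> s" "\<not> int p dvd h"
  shows "has_residue (\<lambda>k. \<phi> (h * k)) s"
  using assms(1)
proof (induction rule: has_residue.induct)
  case (zeta a)
  show ?case using has_residue.zeta[of "h * a"] by (simp add: ac_simps)
next
  case (diff \<phi> s \<psi> t)
  then show ?case by (intro has_residue.diff)
next
  case (agree \<phi> s \<psi>)
  show ?case
    using agree.hyps(2) assms(2)
    by (intro has_residue.agree[OF agree.IH]) (simp add: p_dvd_mult_iff)
qed

lemma has_residue_cnj: "has_residue \<phi> s \<Longrightarrow> has_residue (\<lambda>k. cnj (\<phi> k)) s"
proof (induction rule: has_residue.induct)
  case (zeta a)
  show ?case using has_residue.zeta[of "- a"] by simp
next
  case (diff \<phi> s \<psi> t)
  show ?case using has_residue.diff[OF diff.IH] by simp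
next
  case (agree \<phi> s \<psi>)
  show ?case using agree.hyps(2) by (intro has_residue.agree[OF agree.IH]) simp
qed

lemma cyclotomic_integer_zeta: "cyclotomic_integer (\<lambda>k. \<zeta> (k * a))"
  by (rule cyclotomic_integerI[OF has_residue.zeta])

lemma cyclotomic_integer_of_int: "cyclotomic_integer (\<lambda>k. of_int m)"
  by (rule cyclotomic_integerI[OF has_residue_of_int])

lemma cyclotomic_integer_of_nat: "cyclotomic_integer (\<lambda>k. of_nat m)"
  using cyclotomic_integer_of_int[of "int m"] by simp

lemma cyclotomic_integer_numeral: "cyclotomic_integer (\<lambda>k. numeral m)"
  using cyclotomic_integer_of_int[of "numeral m"] by simp

lemma cyclotomic_integer_1: "cyclotomic_integer (\<lambda>k. 1)"
  using cyclotomic_integer_of_int[of 1] by simp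

lemma cyclotomic_integer_add:
  "cyclotomic_integer \<phi> \<Longrightarrow> cyclotomic_integer \<psi> \<Longrightarrow> cyclotomic_integer (\<lambda>k. \<phi> k + \<psi> k)"
  unfolding cyclotomic_integer_def by (blast intro: has_residue_add)

lemma cyclotomic_integer_minus: "cyclotomic_integer \<phi> \<Longrightarrow> cyclotomic_integer (\<lambda>k. - \<phi> k)"
  unfolding cyclotomic_integer_def by (blast intro: has_residue_minus)

lemma cyclotomic_integer_diff:
  "cyclotomic_integer \<phi> \<Longrightarrow> cyclotomic_integer \<psi> \<Longrightarrow> cyclotomic_integer (\<lambda>k. \<phi> k - \<psi> k)"
  unfolding cyclotomic_integer_def by (blast intro: has_residue.diff)

lemma cyclotomic_integer_mult:
  "cyclotomic_integer \<phi> \<Longrightarrow> cyclotomic_integer \<psi> \<Longrightarrow> cyclotomic_integer (\<lambda>k. \<phi> k * \<psi> k)"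
  unfolding cyclotomic_integer_def by (blast intro: has_residue_mult)

lemma cyclotomic_integer_power: "cyclotomic_integer \<phi> \<Longrightarrow> cyclotomic_integer (\<lambda>k. \<phi> k ^ n)"
  unfolding cyclotomic_integer_def by (blast intro: has_residue_power)

lemma cyclotomic_integer_sum:
  "(\<And>i. i \<in> A \<Longrightarrow> cyclotomic_integer (\<phi> i)) \<Longrightarrow> cyclotomic_integer (\<lambda>k. \<Sum>i\<in>A. \<phi> i k)"
  unfolding cyclotomic_integer_def using has_residue_sum by metis

lemma cyclotomic_integer_cnj: "cyclotomic_integer \<phi> \<Longrightarrow> cyclotomic_integer (\<lambda>k. cnj (\<phi> k))"
  unfolding cyclotomic_integer_def by (blast intro: has_residue_cnj)

lemmas cyclotomic_integer_intros =
  cyclotomic_integer_zeta cyclotomic_integer_of_int cyclotomic_integer_of_nat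
  cyclotomic_integer_numeral cyclotomic_integer_1 cyclotomic_integer_add cyclotomic_integer_minus
  cyclotomic_integer_diff cyclotomic_integer_mult cyclotomic_integer_power cyclotomic_integer_sum
  cyclotomic_integer_cnj

lemma cyclotomic_integer_periodic:
  assumes "cyclotomic_integer \<phi>" "[j = k] (mod int p)" "\<not> int p dvd k"
  shows "\<phi> j = \<phi> k"
proof -
  obtain s where "has_residue \<phi> s" using assms(1) by (rule cyclotomic_integerE)
  moreover have "\<not> int p dvd j" using assms(2,3) by (simp add: cong_dvd_iff)
  ultimately show ?thesis
  proof (induction rule: has_residue.induct)
    case (zeta a)
    show ?case using assms(2) by (intro unity_root_cong cong_scalar_right)
  next
    case (diff \<phi> s \<psi> t)
    then show ?case by simp
  next
    case (agree \<phi> s \<psi>)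
    then show ?case using assms(3) by simp
  qed
qed

lemma conjugate_representative:
  assumes "\<not> int p dvd k"
  obtains i where "i \<in> {1..<int p}" "\<And>\<phi>. cyclotomic_integer \<phi> \<Longrightarrow> \<phi> i = \<phi> k"
proof
  have "k mod int p \<noteq> 0" using assms by (simp add: dvd_eq_mod_eq_0)
  moreover have "0 \<le> k mod int p" "k mod int p < int p" by simp_all
  ultimately show "k mod int p \<in> {1..<int p}"
    unfolding atLeastLessThan_iff by linarith
  show "\<phi> (k mod int p) = \<phi> k" if "cyclotomic_integer \<phi>" for \<phi>
    using that assms by (intro cyclotomic_integer_periodic) simp_all
qed

lemma trace_cong_residue:
  assumes "has_residue \<phi> s"
  obtains t where "(\<Sum>k\<in>{1..<int p}. \<phi> k) = of_int t" "[t = - s] (mod int p)"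
proof -
  have "\<exists>t. (\<Sum>k\<in>{1..<int p}. \<phi> k) = of_int t \<and> [t = - s] (mod int p)"
    using assms
  proof (induction rule: has_residue.induct)
    case (zeta a)
    have "{0..<int p} = insert 0 {1..<int p}" by auto
    then have "(\<Sum>k\<in>{1..<int p}. \<zeta> (k * a)) = (\<Sum>k\<in>{0..<int p}. \<zeta> (a * k)) - 1"
      by (simp add: mult.commute)
    also have "\<dots> = of_int ((if int p dvd a then int p else 0) - 1)"
      by (simp add: sum_unity_root)
    finally show ?case
      by (intro exI[of _ "(if int p dvd a then int p else 0) - 1"] conjI)
        (simp_all add: cong_iff_dvd_diff)
  next
    case (diff \<phi> s \<psi> t)
    then obtain x y where "(\<Sum>k\<in>{1..<int p}. \<phi> k) = of_int x" "[x = - s] (mod int p)"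
      "(\<Sum>k\<in>{1..<int p}. \<psi> k) = of_int y" "[y = - t] (mod int p)" by blast
    then show ?case
      using cong_diff[of x "- s" "int p" y "- t"]
      by (intro exI[of _ "x - y"]) (simp add: sum_subtractf)
  next
    case (agree \<phi> s \<psi>)
    then have "(\<Sum>k\<in>{1..<int p}. \<psi> k) = (\<Sum>k\<in>{1..<int p}. \<phi> k)"
      by (intro sum.cong refl agree.hyps(2) not_p_dvd)
    then show ?case using agree.IH by simp
  qed
  then show thesis using that by blast
qed

lemma has_residue_unique:
  assumes "has_residue \<phi> s" "has_residue \<phi> t"
  shows "[s = t] (mod int p)"
proof -
  have "has_residue (\<lambda>k. 0) (s - t)" using has_residue.diff[OF assms] by simp
  then obtain x where "(\<Sum>k\<in>{1..<int p}. 0 :: complex) = of_int x" "[x = - (s - t)] (mod int p)"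
    by (rule trace_cong_residue)
  then show ?thesis by (simp add: cong_iff_dvd_diff)
qed

lemma frobenius_mod_2:
  "has_residue \<phi> s \<Longrightarrow> cyclotomic_integer (\<lambda>k. ((\<phi> k)\<^sup>2 - \<phi> (2 * k)) / 2)"
proof (induction rule: has_residue.induct)
  case (zeta a)
  show ?case
    using cyclotomic_integer_of_int[of 0] by (simp add: unity_root_power ac_simps)
next
  case (diff \<phi> s \<psi> t)
  have "cyclotomic_integer
      (\<lambda>k. ((\<phi> k)\<^sup>2 - \<phi> (2 * k)) / 2 - ((\<psi> k)\<^sup>2 - \<psi> (2 * k)) / 2 + (\<psi> k)\<^sup>2 - \<phi> k * \<psi> k)"
    by (intro cyclotomic_integer_intros diff.IH diff.hyps[THEN cyclotomic_integerI])
  then show ?case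
    by (rule cyclotomic_integer_cong) (simp add: field_simps power2_eq_square)
next
  case (agree \<phi> s \<psi>)
  show ?case
    using agree.hyps(2) not_p_dvd_2
    by (intro cyclotomic_integer_cong[OF agree.IH]) (simp add: p_dvd_mult_iff)
qed

text \<open>The ring \<open>\<int>[\<zeta>] / 2\<close> is reduced, because squaring is there the automorphism \<open>\<zeta> \<mapsto> \<zeta>\<^sup>2\<close>.\<close>

lemma two_dvd_if_two_dvd_square:
  assumes "cyclotomic_integer \<phi>" "cyclotomic_integer (\<lambda>k. (\<phi> k)\<^sup>2 / 2)"
  shows "cyclotomic_integer (\<lambda>k. \<phi> k / 2)"
proof -
  obtain s where "has_residue \<phi> s" using assms(1) by (rule cyclotomic_integerE)
  then have "cyclotomic_integer (\<lambda>k. (\<phi> k)\<^sup>2 / 2 - ((\<phi> k)\<^sup>2 - \<phi> (2 * k)) / 2)"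
    by (intro cyclotomic_integer_diff assms(2) frobenius_mod_2)
  then obtain t where double: "has_residue (\<lambda>k. \<phi> (2 * k) / 2) t"
    by (auto simp: cyclotomic_integer_def diff_divide_distrib)
  define h where "h = (int p + 1) div 2"
  have h: "2 * h = int p + 1" using odd_p unfolding h_def by presburger
  then have "\<not> int p dvd 2 * h" using not_p_dvd_1 by (simp add: dvd_add_right_iff)
  then have "\<not> int p dvd h" by (simp add: p_dvd_mult_iff)
  with double have "has_residue (\<lambda>k. \<phi> (2 * (h * k)) / 2) t" by (rule has_residue_conjugate)
  then show ?thesis
  proof (rule cyclotomic_integer_cong[OF cyclotomic_integerI])
    fix k assume "\<not> int p dvd k"
    moreover have "[2 * (h * k) = k] (mod int p)"
      unfolding mult.assoc[symmetric] h by (simp add: cong_iff_dvd_diff distrib_right)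
    ultimately show "\<phi> k / 2 = \<phi> (2 * (h * k)) / 2"
      using cyclotomic_integer_periodic[OF assms(1)] by simp
  qed
qed

abbreviation \<pi> :: "int \<Rightarrow> complex" where
  "\<pi> k \<equiv> 1 - \<zeta> k"

lemma pi_neq_0: "\<not> int p dvd k \<Longrightarrow> \<pi> k \<noteq> 0"
  using zeta_neq_1 by fastforce

lemma has_residue_pi: "has_residue \<pi> 0"
  using has_residue.diff[OF has_residue_of_int[of 1] has_residue.zeta[of 1]] by simp

lemma pi_dvd_diff_residue:
  "has_residue \<phi> s \<Longrightarrow> cyclotomic_integer (\<lambda>k. (\<phi> k - of_int s) / \<pi> k)"
proof (induction rule: has_residue.induct)
  case (zeta a)
  define n where "n = nat (a mod int p)"
  have "cyclotomic_integer (\<lambda>k. - (\<Sum>i<n. \<zeta> (k * int i)))"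
    by (intro cyclotomic_integer_intros)
  then show ?case
  proof (rule cyclotomic_integer_cong)
    fix k assume k: "\<not> int p dvd k"
    have "[k * a = k * int n] (mod int p)"
      unfolding n_def by (intro cong_scalar_left) (simp add: cong_def)
    then have "\<zeta> (k * a) = \<zeta> k ^ n"
      by (simp add: unity_root_power unity_root_cong)
    then have "\<zeta> (k * a) - 1 = \<pi> k * - (\<Sum>i<n. \<zeta> (k * int i))"
      using one_diff_power_eq[of "\<zeta> k" n] by (simp add: unity_root_power algebra_simps)
    then show "(\<zeta> (k * a) - of_int 1) / \<pi> k = - (\<Sum>i<n. \<zeta> (k * int i))"
      using pi_neq_0[OF k] by simp
  qed
next
  case (diff \<phi> s \<psi> t)
  show ?case
    by (rule cyclotomic_integer_cong[OF cyclotomic_integer_diff[OF diff.IH]])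
      (simp add: algebra_simps flip: diff_divide_distrib)
next
  case (agree \<phi> s \<psi>)
  show ?case using agree.hyps(2) by (intro cyclotomic_integer_cong[OF agree.IH]) simp
qed

lemma pi_dvd_p: "cyclotomic_integer (\<lambda>k. of_nat p / \<pi> k)"
proof -
  have "has_residue (\<lambda>k. \<Sum>i\<in>{0..<int p}. \<zeta> (k * i)) (int p)"
    using has_residue_sum[of "{0..<int p}", OF has_residue.zeta] by simp
  then have "cyclotomic_integer (\<lambda>k. - (((\<Sum>i\<in>{0..<int p}. \<zeta> (k * i)) - of_int (int p)) / \<pi> k))"
    by (intro cyclotomic_integer_minus pi_dvd_diff_residue)
  then show ?thesis
    by (rule cyclotomic_integer_cong) (simp add: sum_unity_root)
qed

lemma pi_dvd_if_p_dvd_residue: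
  assumes "has_residue \<phi> s" "int p dvd s"
  shows "cyclotomic_integer (\<lambda>k. \<phi> k / \<pi> k)"
proof -
  obtain t where s: "s = int p * t" using assms(2) by blast
  have "cyclotomic_integer (\<lambda>k. (\<phi> k - of_int s) / \<pi> k + of_int t * (of_nat p / \<pi> k))"
    by (intro cyclotomic_integer_intros pi_dvd_diff_residue assms(1) pi_dvd_p)
  then show ?thesis
    by (rule cyclotomic_integer_cong) (simp add: s mult.commute flip: add_divide_distrib)
qed

lemma power_p_minus_1_eq_if_shifted_root_of_unity:
  fixes y :: complex
  assumes "(y + 1) ^ p = 1" "y \<noteq> 0"
  shows "y ^ (p - 1) = of_nat p * - (\<Sum>i<p - 1. of_nat ((p choose Suc i) div p) * y ^ i)"
proof -
  define n where "n = p - 1"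
  have p: "p = Suc n" by (simp add: n_def)
  have choose: "p choose Suc i = p * ((p choose Suc i) div p)" if "i < n" for i
    using dvd_choose_prime[of "Suc i" p] that prime_p by (simp add: n_def)
  have "1 = (\<Sum>i\<le>Suc n. of_nat (p choose i) * y ^ i)"
    using assms(1) unfolding binomial_ring p by simp
  also have "\<dots> = 1 + y * ((\<Sum>i<n. of_nat (p choose Suc i) * y ^ i) + y ^ n)"
    by (subst sum.atMost_Suc_shift)
      (simp add: p sum_distrib_left algebra_simps del: binomial_Suc_Suc flip: lessThan_Suc_atMost)
  also have "(\<Sum>i<n. of_nat (p choose Suc i) * y ^ i)
      = (\<Sum>i<n. of_nat (p * ((p choose Suc i) div p)) * y ^ i)"
    using choose by (intro sum.cong) auto
  also have "\<dots> = of_nat p * (\<Sum>i<n. of_nat ((p choose Suc i) div p) * y ^ i)"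
    by (simp add: sum_distrib_left mult.assoc)
  finally show ?thesis
    unfolding n_def[symmetric] using assms(2) by (simp add: eq_neg_iff_add_eq_0 add.commute)
qed

lemma has_residue_pi_power_div_p: "has_residue (\<lambda>k. \<pi> k ^ (p - 1) / of_nat p) (- 1)"
proof -
  let ?b = "\<lambda>i. int ((p choose Suc i) div p)"
  have "has_residue (\<lambda>k. - (\<Sum>i<p - 1. of_int (?b i) * (- \<pi> k) ^ i))
      (- (\<Sum>i<p - 1. ?b i * (- 0) ^ i))"
    by (intro has_residue_minus has_residue_sum has_residue_mult has_residue_power
        has_residue_of_int has_residue_pi)
  moreover have "(\<Sum>i<p - 1. ?b i * (- 0) ^ i) = 1"
    using p_gt_2 by (simp add: power_0_left if_distrib cong: if_cong)
  ultimately have "has_residue (\<lambda>k. - (\<Sum>i<p - 1. of_int (?b i) * (- \<pi> k) ^ i)) (- 1)" by simp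
  then show ?thesis
  proof (rule has_residue.agree)
    fix k assume "\<not> int p dvd k"
    then have "(- \<pi> k) ^ (p - 1)
        = of_nat p * - (\<Sum>i<p - 1. of_nat ((p choose Suc i) div p) * (- \<pi> k) ^ i)"
      using pi_neq_0 by (intro power_p_minus_1_eq_if_shifted_root_of_unity) simp_all
    moreover have "even (p - 1)" using odd_p by simp
    ultimately show "\<pi> k ^ (p - 1) / of_nat p = - (\<Sum>i<p - 1. of_int (?b i) * (- \<pi> k) ^ i)"
      by (simp only: power_minus_even) simp
  qed
qed

text \<open>
  If \<open>\<alpha> / \<pi> ^ j\<close> has residue \<open>s\<close> with \<open>j < p - 1\<close>, then \<open>s\<^sup>2\<close> is also the residue of an element
  divisible by \<open>\<pi>\<close>, as \<open>p\<^sup>2\<close> and the norm of \<open>\<pi> ^ (p - 1)\<close> differ by units at \<open>\<pi>\<close>.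
\<close>

lemma pi_power_dvd_if_p_square_dvd_norm:
  assumes \<alpha>: "cyclotomic_integer \<alpha>"
    and norm: "cyclotomic_integer (\<lambda>k. \<alpha> k * cnj (\<alpha> k) / (of_nat p)\<^sup>2)"
    and "j \<le> p - 1"
  shows "cyclotomic_integer (\<lambda>k. \<alpha> k / \<pi> k ^ j)"
  using assms(3)
proof (induction j)
  case 0
  then show ?case using \<alpha> by simp
next
  case (Suc j)
  define n where "n = p - 1 - j"
  have n: "n > 0" "p - 1 = n + j" using Suc.prems by (auto simp: n_def)
  obtain s where s: "has_residue (\<lambda>k. \<alpha> k / \<pi> k ^ j) s"
    using Suc by (auto simp: cyclotomic_integer_def)
  obtain t where t: "has_residue (\<lambda>k. \<alpha> k * cnj (\<alpha> k) / (of_nat p)\<^sup>2) t"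
    using norm by (rule cyclotomic_integerE)
  define \<psi> where "\<psi> k = \<alpha> k / \<pi> k ^ j * (\<pi> k ^ (p - 1) / of_nat p)" for k
  have "has_residue \<psi> (s * - 1)"
    unfolding \<psi>_def by (intro has_residue_mult s has_residue_pi_power_div_p)
  then have "has_residue (\<lambda>k. \<psi> k * cnj (\<psi> k)) ((s * - 1) * (s * - 1))"
    by (intro has_residue_mult has_residue_cnj)
  moreover have "has_residue (\<lambda>k. \<psi> k * cnj (\<psi> k)) (t * (0 * 0) ^ n)"
  proof (rule has_residue.agree)
    show "has_residue (\<lambda>k. \<alpha> k * cnj (\<alpha> k) / (of_nat p)\<^sup>2 * (\<pi> k * cnj (\<pi> k)) ^ n)
        (t * (0 * 0) ^ n)"
      by (intro has_residue_mult has_residue_power has_residue_cnj t has_residue_pi)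
    fix k assume "\<not> int p dvd k"
    then have "\<psi> k = \<alpha> k * \<pi> k ^ n / of_nat p"
      using pi_neq_0 unfolding \<psi>_def n(2) power_add by simp
    then show "\<psi> k * cnj (\<psi> k) = \<alpha> k * cnj (\<alpha> k) / (of_nat p)\<^sup>2 * (\<pi> k * cnj (\<pi> k)) ^ n"
      by (simp add: power2_eq_square power_mult_distrib)
  qed
  ultimately have "[(s * - 1) * (s * - 1) = t * (0 * 0) ^ n] (mod int p)"
    by (rule has_residue_unique)
  then have "int p dvd s" using n(1) by (simp add: cong_0_iff p_dvd_mult_iff power_0_left)
  from pi_dvd_if_p_dvd_residue[OF s this] show ?case by (simp add: mult.commute)
qed

lemma p_dvd_if_p_square_dvd_norm:
  assumes "cyclotomic_integer \<alpha>" "cyclotomic_integer (\<lambda>k. \<alpha> k * cnj (\<alpha> k) / (of_nat p)\<^sup>2)"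
  shows "cyclotomic_integer (\<lambda>k. \<alpha> k / of_nat p)"
proof -
  have "cyclotomic_integer (\<lambda>k. \<alpha> k / \<pi> k ^ (p - 1) * (\<pi> k ^ (p - 1) / of_nat p))"
    by (intro cyclotomic_integer_mult pi_power_dvd_if_p_square_dvd_norm[OF assms]
        cyclotomic_integerI[OF has_residue_pi_power_div_p]) simp
  then show ?thesis
    by (rule cyclotomic_integer_cong) (use pi_neq_0 in simp)
qed

lemma cyclotomic_integer_div_coprime:
  assumes "cyclotomic_integer \<phi>" "cyclotomic_integer (\<lambda>k. of_int a * \<phi> k / of_int b)" "coprime a b"
  shows "cyclotomic_integer (\<lambda>k. \<phi> k / of_int b)"
proof (cases "b = 0")
  case False
  obtain u v where "u * a + v * b = 1"
    using bezout_int[of a b] assms(3) by auto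
  then have bezout: "of_int u * of_int a + of_int v * of_int b = (1 :: complex)"
    by (metis of_int_1 of_int_add of_int_mult)
  have "cyclotomic_integer (\<lambda>k. of_int u * (of_int a * \<phi> k / of_int b) + of_int v * \<phi> k)"
    by (intro cyclotomic_integer_intros assms)
  then show ?thesis
  proof (rule cyclotomic_integer_cong)
    fix k
    have "\<phi> k / of_int b = (of_int u * of_int a + of_int v * of_int b) * \<phi> k / of_int b"
      unfolding bezout by simp
    then show "\<phi> k / of_int b = of_int u * (of_int a * \<phi> k / of_int b) + of_int v * \<phi> k"
      using False by (simp add: field_simps)
  qed
qed (use cyclotomic_integer_of_int[of 0] in simp)

lemma sum_real_conjugates_in_Ints:
  assumes "cyclotomic_integer \<gamma>" "\<And>k. \<not> int p dvd k \<Longrightarrow> \<gamma> k = of_real (g k)"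
  shows "(\<Sum>k\<in>{1..<int p}. g k) \<in> \<int>"
proof -
  obtain s where "has_residue \<gamma> s" using assms(1) by (rule cyclotomic_integerE)
  then obtain t where t: "(\<Sum>k\<in>{1..<int p}. \<gamma> k) = of_int t" by (rule trace_cong_residue)
  have "complex_of_real (\<Sum>k\<in>{1..<int p}. g k) = of_real (of_int t)"
    unfolding of_real_of_int_eq t[symmetric] by (simp add: assms(2) not_p_dvd)
  then show ?thesis by (simp only: of_real_eq_iff) simp
qed

text \<open>
  The traces of the even powers are nonnegative integers and do not increase with the exponent,
  hence two consecutive ones agree.
\<close>

lemma real_conjugates_bounded_by_1:
  assumes \<gamma>: "cyclotomic_integer \<gamma>"
    and real: "\<And>k. \<not> int p dvd k \<Longrightarrow> \<gamma> k = of_real (g k)"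
    and bound: "\<And>k. \<not> int p dvd k \<Longrightarrow> \<bar>g k\<bar> \<le> 1"
    and k: "\<not> int p dvd k"
  shows "g k \<in> {-1, 0, 1}"
proof -
  let ?I = "{1..<int p}"
  define trace where "trace n = (\<Sum>i\<in>?I. ((g i)\<^sup>2) ^ n)" for n
  have "trace n \<in> \<int>" for n
    unfolding trace_def
  proof (rule sum_real_conjugates_in_Ints)
    show "cyclotomic_integer (\<lambda>k. ((\<gamma> k)\<^sup>2) ^ n)" by (intro cyclotomic_integer_intros \<gamma>)
  qed (simp add: real)
  moreover have "trace n \<ge> 0" for n unfolding trace_def by (intro sum_nonneg) simp
  ultimately have "\<exists>m. trace n = real m" for n using Nats_altdef2 by (fastforce elim: Nats_cases)
  then obtain m where m: "\<And>n. trace n = real (m n)" by metis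
  obtain n where "\<And>i. m n \<le> m i" using ex_has_least_nat[of "\<lambda>_. True" 0 m] by blast
  then have "trace n \<le> trace (Suc n)" by (simp add: m)
  then have "(\<Sum>i\<in>?I. ((g i)\<^sup>2) ^ n - ((g i)\<^sup>2) ^ Suc n) \<le> 0"
    by (simp add: trace_def sum_subtractf)
  moreover have decreasing: "0 \<le> ((g i)\<^sup>2) ^ n - ((g i)\<^sup>2) ^ Suc n" if "i \<in> ?I" for i
    using bound[OF not_p_dvd[OF that]] power_decreasing[of n "Suc n" "(g i)\<^sup>2"]
    by (simp add: abs_square_le_1)
  ultimately have "(\<Sum>i\<in>?I. ((g i)\<^sup>2) ^ n - ((g i)\<^sup>2) ^ Suc n) = 0"
    by (intro antisym sum_nonneg)
  then have stationary: "((g i)\<^sup>2) ^ n = ((g i)\<^sup>2) ^ Suc n" if "i \<in> ?I" for i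
    using decreasing that by (subst (asm) sum_nonneg_eq_0_iff) auto
  obtain i where i: "i \<in> ?I" "\<gamma> i = \<gamma> k"
    using conjugate_representative[OF k] \<gamma> by metis
  then have "g i = g k" using real k not_p_dvd by (metis of_real_eq_iff)
  with stationary[OF i(1)] have "(g k)\<^sup>2 = 0 \<or> (g k)\<^sup>2 = 1" by auto
  then show ?thesis by (auto simp: power2_eq_1_iff)
qed

lemma power_p_minus_1_cong: "[w ^ (p - 1) = (if int p dvd w then 0 else 1)] (mod int p)"
proof -
  define v where "v = nat (w mod int p)"
  have w: "[w = int v] (mod int p)" by (simp add: v_def cong_def)
  then have dvd: "int p dvd w \<longleftrightarrow> p dvd v" by (simp add: cong_dvd_iff)
  have "[v ^ (p - 1) = (if p dvd v then 0 else 1)] (mod p)"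
    using fermat_theorem[OF prime_p, of v] p_gt_2
    by (auto simp: cong_0_iff intro: dvd_trans[OF _ dvd_power])
  then have "[int v ^ (p - 1) = (if int p dvd w then 0 else 1)] (mod int p)"
    using cong_int_iff[of "v ^ (p - 1)" "if p dvd v then 0 else 1" p] dvd by (auto split: if_splits)
  with cong_pow[OF w] show ?thesis by (rule cong_trans)
qed

lemma sum_power_p_minus_1_cong_card:
  assumes "finite I"
  shows "[(\<Sum>i\<in>I. w i ^ (p - 1)) = int (card {i\<in>I. \<not> int p dvd w i})] (mod int p)"
proof -
  have "[(\<Sum>i\<in>I. w i ^ (p - 1)) = (\<Sum>i\<in>I. if int p dvd w i then 0 else 1)] (mod int p)"
    by (intro cong_sum power_p_minus_1_cong)
  also have "(\<Sum>i\<in>I. if int p dvd w i then 0 else 1) = int (card {i\<in>I. \<not> int p dvd w i})"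
    using assms by (simp add: sum.If_cases Collect_conj_eq Collect_neg_eq)
  finally show ?thesis .
qed

text \<open>
  Modulo \<open>p\<close>, the trace of \<open>(\<phi> - s) ^ (p - 1)\<close> is \<open>0\<close> on the one hand, and on the other hand the
  number of conjugates of \<open>\<phi>\<close> not congruent to \<open>s\<close>, which is less than \<open>p\<close>.
\<close>

lemma int_conjugates_cong_residue:
  assumes \<phi>: "has_residue \<phi> s"
    and int: "\<And>k. \<not> int p dvd k \<Longrightarrow> \<phi> k = of_int (v k)"
    and k: "\<not> int p dvd k"
  shows "[v k = s] (mod int p)"
proof -
  let ?I = "{1..<int p}"
  let ?bad = "{i\<in>?I. \<not> int p dvd v i - s}"
  have "has_residue (\<lambda>k. (\<phi> k - of_int s) ^ (p - 1)) ((s - s) ^ (p - 1))"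
    by (intro has_residue_power has_residue.diff \<phi> has_residue_of_int)
  then obtain t where t: "(\<Sum>i\<in>?I. (\<phi> i - of_int s) ^ (p - 1)) = of_int t"
      "[t = - ((s - s) ^ (p - 1))] (mod int p)"
    by (rule trace_cong_residue)
  have "of_int t = (of_int (\<Sum>i\<in>?I. (v i - s) ^ (p - 1)) :: complex)"
    unfolding t(1)[symmetric] by (simp add: int not_p_dvd)
  then have "t = (\<Sum>i\<in>?I. (v i - s) ^ (p - 1))" by (simp only: of_int_eq_iff)
  moreover have "[t = 0] (mod int p)" using t(2) p_gt_2 by (simp add: power_0_left)
  ultimately have "[int (card ?bad) = 0] (mod int p)"
    using sum_power_p_minus_1_cong_card[of ?I "\<lambda>i. v i - s"] by (auto intro: cong_sym cong_trans)
  then have "p dvd card ?bad" by (simp add: cong_0_iff)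
  moreover have "card ?bad \<le> card ?I" by (intro card_mono) auto
  then have "card ?bad < p" unfolding card_atLeastLessThan_int using p_pos by linarith
  ultimately have "card ?bad = 0" using nat_dvd_not_less by blast
  moreover have "finite ?bad" by (rule finite_subset[of _ ?I]) auto
  ultimately have "?bad = {}" by (simp only: card_0_eq)
  moreover obtain i where i: "i \<in> ?I" "\<phi> i = \<phi> k"
    using conjugate_representative[OF k] cyclotomic_integerI[OF \<phi>] by metis
  ultimately have "int p dvd v i - s" by blast
  moreover have "v i = v k" using i int k not_p_dvd by (metis of_int_eq_iff)
  ultimately show ?thesis by (simp add: cong_iff_dvd_diff)
qed

end

section \<open>Flat functions\<close>

lemma parallelogram_equal_norms:
  fixes z w :: complex
  assumes "(z + w) * cnj (z + w) = c" "(z - w) * cnj (z - w) = c"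
  shows "z * cnj z + w * cnj w = c" "z * cnj w + w * cnj z = 0"
proof -
  have "2 * (z * cnj z + w * cnj w) = (z + w) * cnj (z + w) + (z - w) * cnj (z - w)"
    by (simp add: algebra_simps)
  also have "\<dots> = 2 * c" unfolding assms by simp
  finally show "z * cnj z + w * cnj w = c" by (subst (asm) mult_cancel_left) simp
  have "2 * (z * cnj w + w * cnj z) = (z + w) * cnj (z + w) - (z - w) * cnj (z - w)"
    by (simp add: algebra_simps)
  also have "\<dots> = 2 * 0" unfolding assms by simp
  finally show "z * cnj w + w * cnj z = 0" by (subst (asm) mult_cancel_left) simp
qed

lemma unity_root_4:
  "unity_root 4 1 = \<i>" "unity_root 4 2 = - 1" "unity_root 4 3 = - \<i>"
proof -
  show i: "unity_root 4 1 = \<i>" by (simp add: unity_root_def)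
  show minus_1: "unity_root 4 2 = - 1"
    using unity_root_add[of 4 1 1] by (simp add: i)
  show "unity_root 4 3 = - \<i>"
    using unity_root_add[of 4 2 1] by (simp add: i minus_1)
qed

lemma sum_unity_root_4:
  "(\<Sum>x\<in>{0..<4}. unity_root 4 (j * x) * f x) =
    f 0 + unity_root 4 j * f 1 + (unity_root 4 j)\<^sup>2 * f 2 + unity_root 4 j ^ 3 * f 3"
proof -
  have "{0..<4::int} = {0, 1, 2, 3}" by auto
  then show ?thesis by (simp add: unity_root_power add.assoc)
qed

locale flat_quadruple = odd_prime +
  fixes E :: "int \<Rightarrow> int \<Rightarrow> complex"
  assumes cyclotomic_integer_E: "cyclotomic_integer (E x)"
    and flat: "\<not> int p dvd k \<Longrightarrow> (cmod (\<Sum>x\<in>{0..<4}. unity_root 4 (j * x) * E x k))\<^sup>2 = 4 * of_nat p"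
begin

definition even_sum :: "int \<Rightarrow> complex" ("S") where
  "S k = E 0 k + E 2 k"

definition odd_sum :: "int \<Rightarrow> complex" ("T") where
  "T k = E 1 k + E 3 k"

definition even_difference :: "int \<Rightarrow> complex" ("U") where
  "U k = E 0 k - E 2 k"

definition odd_difference :: "int \<Rightarrow> complex" ("V") where
  "V k = E 1 k - E 3 k"

lemma cyclotomic_integer_even_sum: "cyclotomic_integer S"
  unfolding even_sum_def by (intro cyclotomic_integer_intros cyclotomic_integer_E)

lemma cyclotomic_integer_odd_sum: "cyclotomic_integer T"
  unfolding odd_sum_def by (intro cyclotomic_integer_intros cyclotomic_integer_E)

context
  fixes k :: int
  assumes k: "\<not> int p dvd k"
begin

lemma norm_transform:
  assumes "z = E 0 k + unity_root 4 j * E 1 k + (unity_root 4 j)\<^sup>2 * E 2 k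
      + unity_root 4 j ^ 3 * E 3 k"
  shows "z * cnj z = 4 * of_nat p"
proof -
  have "z * cnj z = of_real ((cmod z)\<^sup>2)" by (rule complex_norm_square[symmetric])
  also have "(cmod z)\<^sup>2 = 4 * of_nat p" using flat[OF k, of j] unfolding assms sum_unity_root_4 .
  finally show ?thesis by simp
qed

lemma norm_even_sum_plus_odd_sum: "(S k + T k) * cnj (S k + T k) = 4 * of_nat p"
  by (rule norm_transform[of _ 0]) (simp add: even_sum_def odd_sum_def)

lemma norm_even_sum_minus_odd_sum: "(S k - T k) * cnj (S k - T k) = 4 * of_nat p"
  by (rule norm_transform[of _ 2]) (simp add: unity_root_4 even_sum_def odd_sum_def)

lemma sum_norm_even_odd_sum: "S k * cnj (S k) + T k * cnj (T k) = 4 * of_nat p"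
  and even_sum_cnj_odd_sum_imaginary: "S k * cnj (T k) + T k * cnj (S k) = 0"
  using parallelogram_equal_norms[OF norm_even_sum_plus_odd_sum norm_even_sum_minus_odd_sum] .

lemma sum_cmod_even_odd_sum: "(cmod (S k))\<^sup>2 + (cmod (T k))\<^sup>2 = 4 * of_nat p"
proof -
  have "complex_of_real ((cmod (S k))\<^sup>2 + (cmod (T k))\<^sup>2) = of_real (4 * of_nat p)"
    unfolding of_real_add complex_norm_square sum_norm_even_odd_sum by simp
  then show ?thesis by (simp only: of_real_eq_iff)
qed

lemma sum_norm_even_odd_difference: "U k * cnj (U k) + V k * cnj (V k) = 4 * of_nat p"
  and even_difference_cnj_odd_difference_real: "U k * cnj (V k) = V k * cnj (U k)"
proof -
  have "(U k + \<i> * V k) * cnj (U k + \<i> * V k) = 4 * of_nat p"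
    by (rule norm_transform[of _ 1])
      (simp add: unity_root_4 power3_eq_cube even_difference_def odd_difference_def algebra_simps)
  moreover have "(U k - \<i> * V k) * cnj (U k - \<i> * V k) = 4 * of_nat p"
    by (rule norm_transform[of _ 3])
      (simp add: unity_root_4 power3_eq_cube even_difference_def odd_difference_def algebra_simps)
  ultimately have parallelogram: "U k * cnj (U k) + \<i> * V k * cnj (\<i> * V k) = 4 * of_nat p"
    "U k * cnj (\<i> * V k) + \<i> * V k * cnj (U k) = 0"
    by (rule parallelogram_equal_norms)+
  show "U k * cnj (U k) + V k * cnj (V k) = 4 * of_nat p"
    using parallelogram(1) by (simp add: algebra_simps)
  have "\<i> * (V k * cnj (U k) - U k * cnj (V k)) = 0"
    using parallelogram(2) by (simp add: algebra_simps)
  then show "U k * cnj (V k) = V k * cnj (U k)" by simp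
qed

end

text \<open>
  Let \<open>F = S + T\<close>. Then \<open>S * cnj F\<close> and its conjugate have sum \<open>2 * |S|\<^sup>2\<close> and product
  \<open>4 * p * |S|\<^sup>2\<close>, so the square of \<open>S * cnj F\<close> vanishes modulo 2. Moreover \<open>|S|\<^sup>2\<close> is modulo 2 a
  combination of \<open>S * cnj F\<close>, \<open>F * cnj e\<close> and \<open>e * cnj F\<close> for some \<open>e\<close>, so its square vanishes too.
\<close>

lemma two_dvd_even_sum_cnj: "cyclotomic_integer (\<lambda>k. S k * cnj (S k + T k) / 2)"
proof (rule two_dvd_if_two_dvd_square)
  show "cyclotomic_integer (\<lambda>k. S k * cnj (S k + T k))"
    by (intro cyclotomic_integer_intros cyclotomic_integer_even_sum cyclotomic_integer_odd_sum)
  have "cyclotomic_integer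
      (\<lambda>k. S k * cnj (S k + T k) * (S k * cnj (S k)) - 2 * of_nat p * (S k * cnj (S k)))"
    by (intro cyclotomic_integer_intros cyclotomic_integer_even_sum cyclotomic_integer_odd_sum)
  then show "cyclotomic_integer (\<lambda>k. (S k * cnj (S k + T k))\<^sup>2 / 2)"
  proof (rule cyclotomic_integer_cong)
    fix k assume k: "\<not> int p dvd k"
    define a n where "a = S k * cnj (S k + T k)" and "n = S k * cnj (S k)"
    have sum: "a + cnj a = 2 * n"
      using even_sum_cnj_odd_sum_imaginary[OF k] by (simp add: a_def n_def algebra_simps)
    have "a * cnj a = n * ((S k + T k) * cnj (S k + T k))"
      by (simp add: a_def n_def algebra_simps)
    also note norm_even_sum_plus_odd_sum[OF k]
    finally have product: "a * cnj a = n * (4 * of_nat p)" .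
    have "a\<^sup>2 = a * (a + cnj a) - a * cnj a" by (simp add: power2_eq_square algebra_simps)
    also have "\<dots> = 2 * (a * n - 2 * of_nat p * n)"
      unfolding sum product by (simp add: algebra_simps)
    finally show "(S k * cnj (S k + T k))\<^sup>2 / 2
        = S k * cnj (S k + T k) * (S k * cnj (S k)) - 2 * of_nat p * (S k * cnj (S k))"
      by (simp add: a_def n_def)
  qed
qed

lemma norm_even_sum_decomposition:
  fixes k
  assumes k: "\<not> int p dvd k"
  defines "F \<equiv> S k + T k" and "e \<equiv> E 2 k + E 3 k"
  shows "S k * cnj (S k) = S k * cnj F + F * cnj e + e * cnj F
    - 2 * (e * cnj e + S k * cnj (E 3 k) + E 2 k * cnj (T k) - 2 * (E 2 k * cnj (E 3 k)))"
proof -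
  have UV: "U k = S k - 2 * E 2 k" "V k = T k - 2 * E 3 k"
    by (simp_all add: even_sum_def odd_sum_def even_difference_def odd_difference_def)
  have "F * cnj F - 2 * (F * cnj e + e * cnj F) + 4 * (e * cnj e) = (U k + V k) * cnj (U k + V k)"
    by (simp add: UV F_def e_def algebra_simps)
  also have "\<dots> = U k * cnj (U k) + V k * cnj (V k) + (U k * cnj (V k) + V k * cnj (U k))"
    by (simp add: algebra_simps)
  also have "\<dots> = F * cnj F + 2 * (U k * cnj (V k))"
    unfolding sum_norm_even_odd_difference[OF k] F_def norm_even_sum_plus_odd_sum[OF k]
      even_difference_cnj_odd_difference_real[OF k] by simp
  finally have "2 * (U k * cnj (V k)) = 2 * (2 * (e * cnj e) - (F * cnj e + e * cnj F))"
    by (simp add: algebra_simps)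
  then have "U k * cnj (V k) = 2 * (e * cnj e) - (F * cnj e + e * cnj F)"
    by (subst (asm) mult_cancel_left) simp
  moreover have "U k * cnj (V k) = S k * cnj F - S k * cnj (S k)
      - 2 * (S k * cnj (E 3 k) + E 2 k * cnj (T k) - 2 * (E 2 k * cnj (E 3 k)))"
    by (simp add: UV F_def algebra_simps)
  ultimately show ?thesis by (simp add: algebra_simps)
qed

lemma two_dvd_norm_even_sum: "cyclotomic_integer (\<lambda>k. S k * cnj (S k) / 2)"
proof (rule two_dvd_if_two_dvd_square)
  show "cyclotomic_integer (\<lambda>k. S k * cnj (S k))"
    by (intro cyclotomic_integer_intros cyclotomic_integer_even_sum)
  define A where "A k = S k * cnj (S k + T k) / 2" for k
  define e where "e k = E 2 k + E 3 k" for k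
  define Q where "Q k = e k * cnj (e k) + S k * cnj (E 3 k) + E 2 k * cnj (T k)
      - 2 * (E 2 k * cnj (E 3 k))" for k
  have "cyclotomic_integer (\<lambda>k. S k * cnj (S k) * A k + cnj (A k) * (S k * cnj (e k))
      + A k * (cnj (S k) * e k) - S k * cnj (S k) * Q k)"
    unfolding A_def e_def Q_def
    by (intro cyclotomic_integer_intros cyclotomic_integer_E cyclotomic_integer_even_sum
        cyclotomic_integer_odd_sum two_dvd_even_sum_cnj)
  then show "cyclotomic_integer (\<lambda>k. (S k * cnj (S k))\<^sup>2 / 2)"
  proof (rule cyclotomic_integer_cong)
    fix k assume k: "\<not> int p dvd k"
    have "(S k * cnj (S k))\<^sup>2 = S k * cnj (S k) * (S k * cnj (S k + T k)
        + (S k + T k) * cnj (e k) + e k * cnj (S k + T k) - 2 * Q k)"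
      unfolding power2_eq_square using norm_even_sum_decomposition[OF k] by (simp only: Q_def e_def)
    also have "\<dots> = 2 * (S k * cnj (S k) * A k + cnj (A k) * (S k * cnj (e k))
        + A k * (cnj (S k) * e k) - S k * cnj (S k) * Q k)"
      by (simp add: A_def field_simps)
    finally show "(S k * cnj (S k))\<^sup>2 / 2 = S k * cnj (S k) * A k + cnj (A k) * (S k * cnj (e k))
        + A k * (cnj (S k) * e k) - S k * cnj (S k) * Q k"
      by simp
  qed
qed

definition \<beta> :: "int \<Rightarrow> complex" where
  "\<beta> k = (S k + T k) * cnj (S k - T k) / of_nat p"

lemma norm_\<beta>:
  assumes k: "\<not> int p dvd k"
  shows "\<beta> k * cnj (\<beta> k) = 16"
proof -
  have "\<beta> k * cnj (\<beta> k)
      = ((S k + T k) * cnj (S k + T k)) * ((S k - T k) * cnj (S k - T k)) / (of_nat p)\<^sup>2"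
    by (simp add: \<beta>_def power2_eq_square)
  also have "\<dots> = 16"
    unfolding norm_even_sum_plus_odd_sum[OF k] norm_even_sum_minus_odd_sum[OF k]
    by (simp add: power2_eq_square)
  finally show ?thesis .
qed

lemma cyclotomic_integer_\<beta>: "cyclotomic_integer \<beta>"
  unfolding \<beta>_def
proof (rule p_dvd_if_p_square_dvd_norm)
  show "cyclotomic_integer (\<lambda>k. (S k + T k) * cnj (S k - T k))"
    by (intro cyclotomic_integer_intros cyclotomic_integer_even_sum cyclotomic_integer_odd_sum)
  have "(S k + T k) * cnj (S k - T k) * cnj ((S k + T k) * cnj (S k - T k)) / (of_nat p)\<^sup>2 = 16"
    if "\<not> int p dvd k" for k
    using norm_\<beta>[OF that] by (simp add: \<beta>_def power2_eq_square)
  then show "cyclotomic_integer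
      (\<lambda>k. (S k + T k) * cnj (S k - T k) * cnj ((S k + T k) * cnj (S k - T k)) / (of_nat p)\<^sup>2)"
    by (rule cyclotomic_integer_cong[OF cyclotomic_integer_numeral])
qed

lemma \<beta>_plus_cnj_\<beta>:
  assumes k: "\<not> int p dvd k"
  shows "\<beta> k + cnj (\<beta> k) = 4 * (S k * cnj (S k)) / of_nat p - 8"
proof -
  have "(S k + T k) * cnj (S k - T k) + cnj ((S k + T k) * cnj (S k - T k))
      = 4 * (S k * cnj (S k)) - 2 * (S k * cnj (S k) + T k * cnj (T k))"
    by (simp add: algebra_simps)
  then have "of_nat p * (\<beta> k + cnj (\<beta> k)) = 4 * (S k * cnj (S k)) - 8 * of_nat p"
    unfolding sum_norm_even_odd_sum[OF k] by (simp add: \<beta>_def field_simps)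
  then show ?thesis by (simp add: field_simps)
qed

lemma two_p_dvd_norm_even_sum: "cyclotomic_integer (\<lambda>k. S k * cnj (S k) / (2 * of_nat p))"
proof -
  have "cyclotomic_integer (\<lambda>k. \<beta> k + cnj (\<beta> k) + 8)"
    by (intro cyclotomic_integer_intros cyclotomic_integer_\<beta>)
  then have "cyclotomic_integer (\<lambda>k. of_int 8 * (S k * cnj (S k) / 2) / of_int (int p))"
    by (rule cyclotomic_integer_cong) (simp add: \<beta>_plus_cnj_\<beta>)
  moreover have "coprime 8 (int p)"
    using coprime_2_power_p[of 3] coprime_int_iff[of 8 p] by simp
  ultimately have "cyclotomic_integer (\<lambda>k. S k * cnj (S k) / 2 / of_int (int p))"
    by (rule cyclotomic_integer_div_coprime[OF two_dvd_norm_even_sum])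
  then show ?thesis by simp
qed

definition excess :: "int \<Rightarrow> real" where
  "excess k = (cmod (S k))\<^sup>2 / (2 * of_nat p) - 1"

lemma excess_trichotomy:
  assumes k: "\<not> int p dvd k"
  shows "excess k \<in> {-1, 0, 1}"
proof (rule real_conjugates_bounded_by_1[OF _ _ _ k])
  show "cyclotomic_integer (\<lambda>k. S k * cnj (S k) / (2 * of_nat p) - 1)"
    by (intro cyclotomic_integer_diff two_p_dvd_norm_even_sum cyclotomic_integer_1)
  show "S k * cnj (S k) / (2 * of_nat p) - 1 = of_real (excess k)" for k
    by (simp add: excess_def flip: complex_norm_square)
  show "\<bar>excess k\<bar> \<le> 1" if k: "\<not> int p dvd k" for k
  proof -
    have "(cmod (S k))\<^sup>2 \<le> (cmod (S k))\<^sup>2 + (cmod (T k))\<^sup>2" by simp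
    also have "\<dots> = 4 * of_nat p" by (rule sum_cmod_even_odd_sum[OF k])
    finally have "(cmod (S k))\<^sup>2 / (2 * of_nat p) \<le> 2" by (simp add: divide_le_eq)
    moreover have "0 \<le> (cmod (S k))\<^sup>2 / (2 * of_nat p)" by simp
    ultimately show ?thesis unfolding excess_def by linarith
  qed
qed

lemma norm_\<beta>_minus_cnj_\<beta>:
  assumes k: "\<not> int p dvd k"
  shows "(\<beta> k - cnj (\<beta> k)) * cnj (\<beta> k - cnj (\<beta> k)) = of_int (if excess k = 0 then 64 else 0)"
proof -
  have sum: "\<beta> k + cnj (\<beta> k) = of_real (8 * excess k)"
    unfolding \<beta>_plus_cnj_\<beta>[OF k] by (simp add: excess_def field_simps flip: complex_norm_square)
  have "(\<beta> k - cnj (\<beta> k)) * cnj (\<beta> k - cnj (\<beta> k)) = 4 * (\<beta> k * cnj (\<beta> k)) - (\<beta> k + cnj (\<beta> k))\<^sup>2"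
    by (simp add: power2_eq_square algebra_simps)
  also have "\<dots> = of_real (64 * (1 - (excess k)\<^sup>2))"
    unfolding norm_\<beta>[OF k] sum by (simp add: power2_eq_square)
  finally show ?thesis using excess_trichotomy[OF k] by auto
qed

text \<open>
  Complex conjugation preserves residues, so \<open>\<beta> - cnj \<beta>\<close> is divisible by \<open>1 - \<zeta>\<close>. If \<open>excess k = 0\<close>,
  its norm would be \<open>64\<close>, which is prime to \<open>p\<close>.
\<close>

lemma excess_neq_0:
  assumes k: "\<not> int p dvd k"
  shows "excess k \<noteq> 0"
proof
  assume zero: "excess k = 0"
  obtain r where "has_residue \<beta> r" using cyclotomic_integer_\<beta> by (rule cyclotomic_integerE)
  then have "has_residue (\<lambda>k. \<beta> k - cnj (\<beta> k)) (r - r)"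
    by (intro has_residue.diff has_residue_cnj)
  then have "has_residue (\<lambda>k. (\<beta> k - cnj (\<beta> k)) * cnj (\<beta> k - cnj (\<beta> k))) ((r - r) * (r - r))"
    by (intro has_residue_mult has_residue_cnj)
  from int_conjugates_cong_residue[OF this norm_\<beta>_minus_cnj_\<beta> k]
  have "[64 = 0] (mod int p)" using zero by simp
  then have "int p dvd 2 ^ 6 * 1" by (simp add: cong_0_iff)
  then show False using not_p_dvd_1 by (simp only: p_dvd_2_power_mult_iff)
qed

lemma even_sum_eq_0_or_odd_sum_eq_0:
  assumes k: "\<not> int p dvd k"
  shows "S k = 0 \<or> T k = 0"
proof -
  consider (minus_one) "excess k = - 1" | (one) "excess k = 1"
    using excess_trichotomy[OF k] excess_neq_0[OF k] by auto
  then show ?thesis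
  proof cases
    case minus_one
    then show ?thesis by (simp add: excess_def)
  next
    case one
    then have "(cmod (S k))\<^sup>2 = 4 * of_nat p" by (simp add: excess_def field_simps)
    then show ?thesis using sum_cmod_even_odd_sum[OF k] by simp
  qed
qed

lemma cmod_even_sum_eq:
  assumes "\<not> int p dvd k"
  shows "(cmod (S k))\<^sup>2 = (if T k = 0 then 4 * of_nat p else 0)"
  using even_sum_eq_0_or_odd_sum_eq_0[OF assms] sum_cmod_even_odd_sum[OF assms] by auto

end

context odd_prime
begin

definition graph_sum :: "(int \<Rightarrow> int) \<Rightarrow> int \<Rightarrow> int \<Rightarrow> complex" where
  "graph_sum f c k = (\<Sum>t\<in>{0..<int p}. \<zeta> (k * (f t + c * t)))"

lemma cyclotomic_integer_graph_sum: "cyclotomic_integer (graph_sum f c)"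
  unfolding graph_sum_def by (intro cyclotomic_integer_intros)

lemma sum_norm_graph_sum_add:
  assumes "\<not> int p dvd k"
  shows "(\<Sum>c\<in>{0..<int p}. (cmod (graph_sum f c k + graph_sum h c k))\<^sup>2)
    = of_nat p * (\<Sum>t\<in>{0..<int p}. (cmod (\<zeta> (k * f t) + \<zeta> (k * h t)))\<^sup>2)"
proof -
  have "of_nat p * (\<Sum>t\<in>{0..<int p}. (cmod (\<zeta> (k * f t) + \<zeta> (k * h t)))\<^sup>2)
    = (\<Sum>c\<in>{0..<int p}. (cmod (\<Sum>t\<in>{0..<int p}. (\<zeta> (k * f t) + \<zeta> (k * h t)) * \<zeta> (k * c * t)))\<^sup>2)"
    by (intro parseval_unity_root[symmetric] coprime_p assms) simp_all
  also have "\<dots> = (\<Sum>c\<in>{0..<int p}. (cmod (graph_sum f c k + graph_sum h c k))\<^sup>2)"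
    by (simp add: graph_sum_def distrib_right distrib_left sum.distrib mult.assoc unity_root_add)
  finally show ?thesis by (rule sym)
qed

lemma graph_sum_add_neq_0:
  assumes "\<not> int p dvd k"
  shows "\<exists>c\<in>{0..<int p}. graph_sum f c k + graph_sum h c k \<noteq> 0"
proof (rule ccontr)
  assume "\<not> ?thesis"
  then have "(\<Sum>t\<in>{0..<int p}. (cmod (\<zeta> (k * f t) + \<zeta> (k * h t)))\<^sup>2) = 0"
    using sum_norm_graph_sum_add[OF assms, of f h] by simp
  then have "\<forall>t\<in>{0..<int p}. \<zeta> (k * f t) + \<zeta> (k * h t) = 0"
    by (subst (asm) sum_nonneg_eq_0_iff) auto
  then have "\<zeta> (k * f 0) + \<zeta> (k * h 0) = 0" by simp
  then show False by (simp add: zeta_add_neq_0)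
qed

lemma has_residue_sum_norm_zeta_add:
  "has_residue (\<lambda>k. of_real (\<Sum>t\<in>{0..<int p}. (cmod (\<zeta> (k * f t) + \<zeta> (k * h t)))\<^sup>2)) (4 * int p)"
proof -
  have "has_residue
      (\<lambda>k. \<Sum>t\<in>{0..<int p}. (\<zeta> (k * f t) + \<zeta> (k * h t)) * cnj (\<zeta> (k * f t) + \<zeta> (k * h t)))
      (\<Sum>t\<in>{0..<int p}. (1 + 1) * (1 + 1))"
    by (intro has_residue_sum has_residue_mult has_residue_cnj has_residue_add has_residue.zeta)
  then show ?thesis
    unfolding of_real_sum complex_norm_square by (simp add: mult.commute)
qed

text \<open>
  By Parseval, four times the number of \<open>c\<close> for which the odd sum vanishes is a sum of squared norms
  of residue \<open>4 * p\<close>, so this number is \<open>0\<close> or \<open>p\<close>.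
\<close>

lemma exists_non_flat_transform:
  fixes f :: "int \<Rightarrow> int \<Rightarrow> int"
  shows "\<exists>j c k. \<not> int p dvd k \<and>
    (cmod (\<Sum>x\<in>{0..<4}. unity_root 4 (j * x) * graph_sum (f x) c k))\<^sup>2 \<noteq> 4 * of_nat p"
proof (rule ccontr)
  assume "\<not> ?thesis"
  then interpret quadruple: flat_quadruple p "\<lambda>x. graph_sum (f x) c" for c
    by unfold_locales (auto simp: cyclotomic_integer_graph_sum)
  let ?I = "{0..<int p}"
  let ?Z = "\<lambda>k. ?I \<inter> {c. quadruple.odd_sum c k = 0}"
  have count: "(\<Sum>t\<in>?I. (cmod (\<zeta> (k * f 0 t) + \<zeta> (k * f 2 t)))\<^sup>2) = 4 * card (?Z k)"
    if "\<not> int p dvd k" for k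
  proof -
    have "real p * (\<Sum>t\<in>?I. (cmod (\<zeta> (k * f 0 t) + \<zeta> (k * f 2 t)))\<^sup>2)
        = (\<Sum>c\<in>?I. (cmod (quadruple.even_sum c k))\<^sup>2)"
      using sum_norm_graph_sum_add[OF that] by (simp add: quadruple.even_sum_def)
    also have "\<dots> = real p * (4 * card (?Z k))"
      by (simp add: quadruple.cmod_even_sum_eq[OF that] sum.If_cases)
    finally show ?thesis by (simp only: mult_cancel_left) simp
  qed
  have "[int (4 * card (?Z 1)) = 4 * int p] (mod int p)"
    using has_residue_sum_norm_zeta_add[of "f 0" "f 2"] _ not_p_dvd_1
    by (rule int_conjugates_cong_residue) (simp add: count)
  from cong_dvd_iff[OF this] have "int p dvd 2 ^ 2 * int (card (?Z 1))" by simp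
  then have "p dvd card (?Z 1)" by (simp only: p_dvd_2_power_mult_iff) simp
  moreover have "card (?Z 1) \<le> p" using card_mono[of ?I "?Z 1"] by simp
  ultimately consider (empty) "card (?Z 1) = 0" | (full) "card (?Z 1) = card ?I"
    by (metis card_atLeastLessThan_int diff_zero dvd_imp_le le_antisym nat_int neq0_conv)
  then show False
  proof cases
    case empty
    then have "?Z 1 = {}" by (subst (asm) card_0_eq) auto
    then have "\<forall>c\<in>?I. quadruple.even_sum c 1 = 0"
      using quadruple.even_sum_eq_0_or_odd_sum_eq_0[OF not_p_dvd_1] by auto
    then show False
      using graph_sum_add_neq_0[OF not_p_dvd_1] by (auto simp: quadruple.even_sum_def)
  next
    case full
    then have "?Z 1 = ?I" by (intro card_subset_eq) auto
    then have "\<forall>c\<in>?I. quadruple.odd_sum c 1 = 0" by blast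
    then show False
      using graph_sum_add_neq_0[OF not_p_dvd_1] by (auto simp: quadruple.odd_sum_def)
  qed
qed

end

section \<open>Relative difference sets\<close>

lemma relative_difference_set_inj_mod_subgroup:
  assumes "relative_difference_set G N m n k l R" "r \<in> R" "r' \<in> R" "r \<otimes>\<^bsub>G\<^esub> inv\<^bsub>G\<^esub> r' \<in> N"
  shows "r = r'"
proof -
  have "group G" "R \<subseteq> carrier G"
    and quotient: "g \<in> N \<Longrightarrow> g \<noteq> \<one>\<^bsub>G\<^esub> \<Longrightarrow> r \<in> R \<Longrightarrow> r' \<in> R \<Longrightarrow> g \<noteq> r \<otimes>\<^bsub>G\<^esub> inv\<^bsub>G\<^esub> r'" for g r r'
    using assms(1) unfolding relative_difference_set_def by auto
  interpret group G by fact
  have "r \<otimes>\<^bsub>G\<^esub> inv\<^bsub>G\<^esub> r' = \<one>\<^bsub>G\<^esub>" using quotient[OF assms(4)] assms(2,3) by blast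
  moreover have "r \<in> carrier G" "r' \<in> carrier G" using assms(2,3) \<open>R \<subseteq> carrier G\<close> by auto
  ultimately show ?thesis by (metis inv_closed inv_equality inv_inv)
qed

definition difference_count :: "('a, 'b) monoid_scheme \<Rightarrow> 'a set \<Rightarrow> 'a \<Rightarrow> nat" where
  "difference_count G R g = card {(r1, r2). r1 \<in> R \<and> r2 \<in> R \<and> g = r1 \<otimes>\<^bsub>G\<^esub> inv\<^bsub>G\<^esub> r2}"

lemma norm_sum_unitary_character_eq_sum_differences:
  assumes "group G" "finite (carrier G)" "R \<subseteq> carrier G" and \<chi>: "unitary_character G \<chi>"
  shows "of_real ((cmod (\<Sum>r\<in>R. \<chi> r))\<^sup>2)
    = (\<Sum>g\<in>carrier G. of_nat (difference_count G R g) * \<chi> g)"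
proof -
  interpret group G by fact
  have "finite R" using assms(2,3) by (rule rev_finite_subset)
  let ?d = "\<lambda>(r1, r2). r1 \<otimes>\<^bsub>G\<^esub> inv\<^bsub>G\<^esub> r2"
  have "of_real ((cmod (\<Sum>r\<in>R. \<chi> r))\<^sup>2) = (\<Sum>(r1, r2)\<in>R \<times> R. \<chi> r1 * cnj (\<chi> r2))"
    by (simp only: complex_norm_square cnj_sum sum_product sum.cartesian_product)
  also have "\<dots> = (\<Sum>x\<in>R \<times> R. \<chi> (?d x))"
    using assms(3)
    by (intro sum.cong)
      (auto simp: unitary_character_mult[OF \<chi>] unitary_character_inv[OF \<chi>] subset_iff)
  also have "\<dots> = (\<Sum>g\<in>carrier G. \<Sum>x\<in>{x \<in> R \<times> R. ?d x = g}. \<chi> (?d x))"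
    using assms(2,3) \<open>finite R\<close> by (intro sum.group[symmetric]) auto
  also have "\<dots> = (\<Sum>g\<in>carrier G. of_nat (difference_count G R g) * \<chi> g)"
  proof (intro sum.cong refl)
    fix g
    have pairs: "{(r1, r2). r1 \<in> R \<and> r2 \<in> R \<and> g = r1 \<otimes>\<^bsub>G\<^esub> inv\<^bsub>G\<^esub> r2} = {x \<in> R \<times> R. ?d x = g}"
      by auto
    show "(\<Sum>x\<in>{x \<in> R \<times> R. ?d x = g}. \<chi> (?d x)) = of_nat (difference_count G R g) * \<chi> g"
      unfolding difference_count_def pairs by simp
  qed
  finally show ?thesis .
qed

lemma relative_difference_set_difference_count:
  assumes rds: "relative_difference_set G N m n k l R" and g: "g \<in> carrier G"
  shows "difference_count G R g = (if g = \<one>\<^bsub>G\<^esub> then k else if g \<in> N then 0 else l)"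
proof -
  have G: "group G" and N: "subgroup N G" and R: "R \<subseteq> carrier G" "card R = k"
    and outside: "g \<notin> N \<Longrightarrow> difference_count G R g = l"
    using rds g by (auto simp: relative_difference_set_def difference_count_def)
  interpret group G by fact
  have "difference_count G R g = (if g = \<one>\<^bsub>G\<^esub> then k else 0)" if "g \<in> N"
  proof -
    have "r1 = r2 \<and> g = \<one>\<^bsub>G\<^esub>" if "r1 \<in> R" "r2 \<in> R" "g = r1 \<otimes>\<^bsub>G\<^esub> inv\<^bsub>G\<^esub> r2" for r1 r2
      using relative_difference_set_inj_mod_subgroup[OF rds that(1,2)] that R(1) \<open>g \<in> N\<close> by auto
    moreover have "r \<otimes>\<^bsub>G\<^esub> inv\<^bsub>G\<^esub> r = \<one>\<^bsub>G\<^esub>" if "r \<in> R" for r using that R(1) by auto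
    ultimately have "{(r1, r2). r1 \<in> R \<and> r2 \<in> R \<and> g = r1 \<otimes>\<^bsub>G\<^esub> inv\<^bsub>G\<^esub> r2}
        = (if g = \<one>\<^bsub>G\<^esub> then (\<lambda>r. (r, r)) ` R else {})" by auto
    then show ?thesis using R(2) by (simp add: difference_count_def card_image inj_on_def)
  qed
  then show ?thesis using outside subgroup.one_closed[OF N] by auto
qed

lemma relative_difference_set_norm_character_sum:
  assumes rds: "relative_difference_set G N m n k l R" and \<chi>: "unitary_character G \<chi>"
    and h: "h \<in> N" "\<chi> h \<noteq> 1"
  shows "(cmod (\<Sum>r\<in>R. \<chi> r))\<^sup>2 = of_nat k"
proof -
  have G: "group G" "finite (carrier G)" and N: "subgroup N G" and R: "R \<subseteq> carrier G"
    using rds by (auto simp: relative_difference_set_def)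
  interpret group G by (rule G(1))
  have NG: "N \<subseteq> carrier G" using N by (rule subgroup.subset)
  have one: "\<one>\<^bsub>G\<^esub> \<in> N" using N by (rule subgroup.one_closed)
  let ?c = "difference_count G R"
  have "of_real ((cmod (\<Sum>r\<in>R. \<chi> r))\<^sup>2) = (\<Sum>g\<in>carrier G. of_nat (?c g) * \<chi> g)"
    by (rule norm_sum_unitary_character_eq_sum_differences[OF G R \<chi>])
  also have "\<dots> = (\<Sum>g\<in>carrier G - N. of_nat (?c g) * \<chi> g) + (\<Sum>g\<in>N. of_nat (?c g) * \<chi> g)"
    using NG G(2) by (rule sum.subset_diff)
  also have "(\<Sum>g\<in>carrier G - N. of_nat (?c g) * \<chi> g) = (\<Sum>g\<in>carrier G - N. of_nat l * \<chi> g)"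
    using one by (intro sum.cong) (auto simp: relative_difference_set_difference_count[OF rds])
  also have "\<dots> = of_nat l * ((\<Sum>g\<in>carrier G. \<chi> g) - (\<Sum>g\<in>N. \<chi> g))"
    by (simp add: right_diff_distrib sum_distrib_left sum_diff[OF G(2) NG])
  also have "(\<Sum>g\<in>carrier G. \<chi> g) = 0"
    using h NG by (intro sum_unitary_character[OF \<chi>, of h]) auto
  also have "(\<Sum>g\<in>N. \<chi> g) = 0"
    using sum_unitary_character_subgroup[OF \<chi> N h] .
  also have "(\<Sum>g\<in>N. of_nat (?c g) * \<chi> g) = (\<Sum>g\<in>N. if g = \<one>\<^bsub>G\<^esub> then of_nat k else 0)"
    using NG
    by (intro sum.cong refl)
      (auto simp: relative_difference_set_difference_count[OF rds] unitary_character_one[OF \<chi>])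
  also have "\<dots> = of_nat k"
    using finite_subset[OF NG G(2)] one by simp
  finally show ?thesis by (metis add_0 diff_self mult_zero_right of_real_eq_iff of_real_of_nat_eq)
qed

abbreviation (input) cyclic_times_plane :: "nat \<Rightarrow> nat \<Rightarrow> (int \<times> int \<times> int) monoid" where
  "cyclic_times_plane m p \<equiv> integer_mod_group m \<times>\<times> (integer_mod_group p \<times>\<times> integer_mod_group p)"

lemma group_cyclic_times_plane: "group (cyclic_times_plane m p)"
  by (simp add: DirProd_group)

lemma cyclic_times_plane_pow:
  "(x, y, z) [^]\<^bsub>cyclic_times_plane m p\<^esub> (i :: nat)
    = (int i * x mod int m, int i * y mod int p, int i * z mod int p)"
  by (induction i) (simp_all add: mod_simps algebra_simps)

context odd_prime
begin

lemma subgroup_order_p_contains_multiples: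
  assumes N: "subgroup N (cyclic_times_plane m p)" "card N = p" and m: "coprime m p"
  obtains a b where "\<not> int p dvd a \<or> \<not> int p dvd b"
    "\<And>i :: nat. (0, int i * a mod int p, int i * b mod int p) \<in> N"
proof -
  let ?G = "cyclic_times_plane m p"
  interpret G: group ?G by (rule group_cyclic_times_plane)
  interpret N: group "?G\<lparr>carrier := N\<rparr>"
    using N(1) G.is_group by (rule subgroup.subgroup_is_group)
  have "m \<noteq> 0" using m p_gt_2 by (intro notI) simp
  have "\<not> N \<subseteq> {(0, 0, 0)}" using N(2) p_gt_2 card_mono[of "{(0, 0, 0)}" N] by auto
  then obtain x a b where xab: "(x, a, b) \<in> N" "(x, a, b) \<noteq> (0, 0, 0)" by auto
  then have range: "0 \<le> x" "x < int m" "0 \<le> a" "a < int p" "0 \<le> b" "b < int p"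
    using subgroup.subset[OF N(1)] \<open>m \<noteq> 0\<close> by (auto simp: carrier_integer_mod_group)
  have power: "(int i * x mod int m, int i * a mod int p, int i * b mod int p) \<in> N" for i
    using N.nat_pow_closed[of "(x, a, b)" i] xab(1)
    by (simp add: cyclic_times_plane_pow flip: G.nat_pow_consistent)
  have "(x, a, b) [^]\<^bsub>?G\<^esub> p = (0, 0, 0)"
    using N.pow_order_eq_1[of "(x, a, b)"] xab(1) N(2)
    by (simp add: Coset.order_def flip: G.nat_pow_consistent)
  then have "int m dvd int p * x" by (simp add: cyclic_times_plane_pow dvd_eq_mod_eq_0)
  then have "int m dvd x" using m by (simp add: coprime_dvd_mult_right_iff)
  then have x: "x = 0" using range by (auto dest: zdvd_imp_le)
  show thesis
  proof
    show "\<not> int p dvd a \<or> \<not> int p dvd b" using xab(2) x range by (auto dest: zdvd_imp_le)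
    show "(0, int i * a mod int p, int i * b mod int p) \<in> N" for i
      using power[of i] by (simp add: x)
  qed
qed

lemma subgroup_order_p_contains_line:
  assumes "subgroup N (cyclic_times_plane m p)" "card N = p" "coprime m p"
  obtains a b u v where "[u * a + v * b = 1] (mod int p)"
    "\<And>y z. [b * y = a * z] (mod int p) \<Longrightarrow> (0, y mod int p, z mod int p) \<in> N"
proof -
  obtain a b where ab: "\<not> int p dvd a \<or> \<not> int p dvd b"
    and multiple: "\<And>i :: nat. (0, int i * a mod int p, int i * b mod int p) \<in> N"
    using assms by (rule subgroup_order_p_contains_multiples) blast
  from ab have "coprime a (int p) \<or> coprime b (int p)" by (auto intro: coprime_p)
  then obtain u v where uv: "[u * a + v * b = 1] (mod int p)"
  proof
    assume "coprime a (int p)"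
    then obtain u where "[a * u = 1] (mod int p)" using cong_solve_coprime_int by blast
    then show thesis using that[of u 0] by (simp add: mult.commute)
  next
    assume "coprime b (int p)"
    then obtain v where "[b * v = 1] (mod int p)" using cong_solve_coprime_int by blast
    then show thesis using that[of 0 v] by (simp add: mult.commute)
  qed
  have "(0, y mod int p, z mod int p) \<in> N" if line: "[b * y = a * z] (mod int p)" for y z
  proof -
    define i where "i = nat ((u * y + v * z) mod int p)"
    have i: "[int i * w = (u * y + v * z) * w] (mod int p)" for w
      by (intro cong_scalar_right) (simp add: i_def cong_def)
    have "(u * y + v * z) * a - y = (u * a + v * b - 1) * y - v * (b * y - a * z)"
      "(u * y + v * z) * b - z = (u * a + v * b - 1) * z + u * (b * y - a * z)"
      by (simp_all add: algebra_simps)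
    then have "[(u * y + v * z) * a = y] (mod int p)" "[(u * y + v * z) * b = z] (mod int p)"
      using uv line by (simp_all add: cong_iff_dvd_diff)
    then have "int i * a mod int p = y mod int p" "int i * b mod int p = z mod int p"
      using i[of a] i[of b] by (simp_all add: cong_def)
    then show ?thesis using multiple[of i] by simp
  qed
  with uv show thesis by (rule that)
qed

lemma bij_betw_relative_difference_set:
  assumes rds: "relative_difference_set (cyclic_times_plane m p) N (m * p) p (m * p) l R"
    and "m > 0"
    and line: "\<And>y z. [b * y = a * z] (mod int p) \<Longrightarrow> (0, y mod int p, z mod int p) \<in> N"
  shows "bij_betw (\<lambda>(x, y, z). (x, (b * y - a * z) mod int p)) R ({0..<int m} \<times> {0..<int p})"
    (is "bij_betw ?\<theta> R ?B")
proof -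
  let ?G = "cyclic_times_plane m p"
  have R: "R \<subseteq> {0..<int m} \<times> {0..<int p} \<times> {0..<int p}" "card R = m * p"
    using rds \<open>m > 0\<close> by (simp_all add: relative_difference_set_def carrier_integer_mod_group)
  have inj: "inj_on ?\<theta> R"
  proof (intro inj_onI)
    fix r r' assume r: "r \<in> R" "r' \<in> R" "?\<theta> r = ?\<theta> r'"
    obtain x y z x' y' z' where xyz: "r = (x, y, z)" "r' = (x', y', z')" by (metis prod_cases3)
    have "x = x'" and "[b * y - a * z = b * y' - a * z'] (mod int p)"
      using r(3) by (simp_all add: xyz cong_def)
    then have "[b * (y - y') = a * (z - z')] (mod int p)"
      by (simp add: cong_iff_dvd_diff algebra_simps)
    moreover have "r' \<in> carrier ?G"
      using R(1) r(2) \<open>m > 0\<close> by (auto simp: carrier_integer_mod_group)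
    then have "r \<otimes>\<^bsub>?G\<^esub> inv\<^bsub>?G\<^esub> r' = (0, (y - y') mod int p, (z - z') mod int p)"
      using \<open>x = x'\<close> by (simp add: xyz DirProd_group mod_simps)
    ultimately have "r \<otimes>\<^bsub>?G\<^esub> inv\<^bsub>?G\<^esub> r' \<in> N" using line by simp
    with r(1,2) show "r = r'" by (rule relative_difference_set_inj_mod_subgroup[OF rds])
  qed
  moreover have "?\<theta> ` R = ?B"
  proof (rule card_subset_eq)
    show "?\<theta> ` R \<subseteq> ?B" using R(1) by auto
    show "card (?\<theta> ` R) = card ?B" by (simp add: card_image[OF inj] R(2) card_cartesian_product)
  qed simp
  ultimately show ?thesis by (simp add: bij_betw_def)
qed

definition plane_character :: "nat \<Rightarrow> int \<Rightarrow> int \<Rightarrow> int \<Rightarrow> int \<times> int \<times> int \<Rightarrow> complex" where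
  "plane_character m j d e = (\<lambda>(x, yz). unity_root m (j * x) * (\<lambda>(y, z). \<zeta> (d * y) * \<zeta> (e * z)) yz)"

lemma plane_character_simp [simp]:
  "plane_character m j d e (x, y, z) = unity_root m (j * x) * \<zeta> (d * y + e * z)"
  by (simp add: plane_character_def unity_root_add)

lemma unitary_character_plane_character:
  "unitary_character (cyclic_times_plane m p) (plane_character m j d e)"
  unfolding plane_character_def by (intro unitary_character_DirProd unitary_character_unity_root)

lemma norm_sum_plane_character:
  assumes "relative_difference_set (cyclic_times_plane m p) N m' n k l R"
    and "(0, a mod int p, b mod int p) \<in> N" and nontrivial: "\<not> int p dvd d * a + e * b"
  shows "(cmod (\<Sum>r\<in>R. plane_character m j d e r))\<^sup>2 = of_nat k"
  using assms(1) unitary_character_plane_character assms(2)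
proof (rule relative_difference_set_norm_character_sum)
  have "\<zeta> (d * (a mod int p) + e * (b mod int p)) = \<zeta> (d * a + e * b)"
    by (intro unity_root_cong cong_add cong_scalar_left) simp_all
  then show "plane_character m j d e (0, a mod int p, b mod int p) \<noteq> 1"
    using zeta_neq_1[OF nontrivial] by simp
qed

lemma sum_plane_character_graph:
  assumes bij: "bij_betw (\<lambda>(x, y, z). (x, (b * y - a * z) mod int p)) R ({0..<int m} \<times> {0..<int p})"
  obtains f where "\<And>j c k. (\<Sum>r\<in>R. plane_character m j (k * (u + c * b)) (k * (v - c * a)) r)
    = (\<Sum>x\<in>{0..<int m}. unity_root m (j * x) * graph_sum (f x) c k)"
proof -
  define \<theta> where "\<theta> = (\<lambda>(x :: int, y, z). (x, (b * y - a * z) mod int p))"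
  note bij = bij[folded \<theta>_def]
  define f where "f x t = (case inv_into R \<theta> (x, t) of (_, y, z) \<Rightarrow> u * y + v * z)" for x t
  have "(\<Sum>r\<in>R. plane_character m j (k * (u + c * b)) (k * (v - c * a)) r)
      = (\<Sum>x\<in>{0..<int m}. unity_root m (j * x) * graph_sum (f x) c k)" for j c k
  proof -
    have "plane_character m j (k * (u + c * b)) (k * (v - c * a)) r
        = (case \<theta> r of (x, t) \<Rightarrow> unity_root m (j * x) * \<zeta> (k * (f x t + c * t)))" if "r \<in> R" for r
    proof -
      obtain x y z where r: "r = (x, y, z)" by (metis prod_cases3)
      have "f x ((b * y - a * z) mod int p) = u * y + v * z"
        using bij_betw_inv_into_left[OF bij that] by (simp add: f_def \<theta>_def r)
      moreover have "\<zeta> (k * (u * y + v * z + c * (b * y - a * z)))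
          = \<zeta> (k * (u * y + v * z + c * ((b * y - a * z) mod int p)))"
        by (intro unity_root_cong cong_scalar_left cong_add cong_refl) simp
      ultimately show ?thesis by (simp add: r \<theta>_def algebra_simps)
    qed
    then have "(\<Sum>r\<in>R. plane_character m j (k * (u + c * b)) (k * (v - c * a)) r)
        = (\<Sum>(x, t)\<in>{0..<int m} \<times> {0..<int p}. unity_root m (j * x) * \<zeta> (k * (f x t + c * t)))"
      unfolding sum.reindex_bij_betw[OF bij, symmetric] by (rule sum.cong[OF refl])
    also have "\<dots> = (\<Sum>x\<in>{0..<int m}. unity_root m (j * x) * graph_sum (f x) c k)"
      by (simp add: graph_sum_def sum_distrib_left flip: sum.cartesian_product)
    finally show ?thesis .
  qed
  then show thesis by (rule that)
qed

text \<open>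
  Let \<open>N\<close> be generated by \<open>(0, a, b)\<close>. In the coordinates \<open>t = b * y - a * z\<close>, which vanishes on
  \<open>N\<close>, and \<open>u * y + v * z\<close>, which does not, \<open>R\<close> is the graph of a function of \<open>(x, t)\<close>.
\<close>

lemma relative_difference_set_flat_graph:
  assumes rds: "relative_difference_set (cyclic_times_plane m p) N (m * p) p (m * p) l R"
    and m: "coprime m p"
  obtains f where "\<And>j c k. \<not> int p dvd k \<Longrightarrow>
    (cmod (\<Sum>x\<in>{0..<int m}. unity_root m (j * x) * graph_sum (f x) c k))\<^sup>2 = of_nat (m * p)"
proof -
  have "subgroup N (cyclic_times_plane m p)" "card N = p"
    using rds by (simp_all add: relative_difference_set_def)
  then obtain a b u v where uv: "[u * a + v * b = 1] (mod int p)"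
    and line: "\<And>y z. [b * y = a * z] (mod int p) \<Longrightarrow> (0, y mod int p, z mod int p) \<in> N"
    using m by (rule subgroup_order_p_contains_line) blast
  have "m > 0" using m p_gt_2 by (intro gr0I) simp
  with rds
  have "bij_betw (\<lambda>(x, y, z). (x, (b * y - a * z) mod int p)) R ({0..<int m} \<times> {0..<int p})"
    using line by (rule bij_betw_relative_difference_set)
  then obtain f where
    f: "\<And>j c k. (\<Sum>r\<in>R. plane_character m j (k * (u + c * b)) (k * (v - c * a)) r)
      = (\<Sum>x\<in>{0..<int m}. unity_root m (j * x) * graph_sum (f x) c k)"
    by (rule sum_plane_character_graph) blast
  have generator: "(0, a mod int p, b mod int p) \<in> N" by (rule line) (simp add: mult.commute)
  show thesis
  proof (rule that)
    fix j c k assume k: "\<not> int p dvd k"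
    have "k * (u + c * b) * a + k * (v - c * a) * b = k * (u * a + v * b)"
      by (simp add: algebra_simps)
    then have "\<not> int p dvd k * (u + c * b) * a + k * (v - c * a) * b"
      using k uv not_p_dvd_1 by (simp add: p_dvd_mult_iff cong_dvd_iff)
    from norm_sum_plane_character[OF rds generator this]
    show "(cmod (\<Sum>x\<in>{0..<int m}. unity_root m (j * x) * graph_sum (f x) c k))\<^sup>2 = of_nat (m * p)"
      unfolding f .
  qed
qed

end

theorem theorem4p2:
  fixes p :: nat
  assumes "prime p" and "odd p"
  defines "G \<equiv> integer_mod_group 4 \<times>\<times> (integer_mod_group p \<times>\<times> integer_mod_group p)"
  shows "\<not> (\<exists>N R. subgroup N G \<and> card N = p \<and>
               relative_difference_set G N (4 * p) p (4 * p) 4 R)"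
proof
  interpret odd_prime p by unfold_locales fact+
  assume "\<exists>N R. subgroup N G \<and> card N = p \<and> relative_difference_set G N (4 * p) p (4 * p) 4 R"
  then obtain N R where "relative_difference_set G N (4 * p) p (4 * p) 4 R" by blast
  moreover have "coprime 4 p" using coprime_2_power_p[of 2] by simp
  ultimately obtain f where "\<And>j c k. \<not> int p dvd k \<Longrightarrow>
      (cmod (\<Sum>x\<in>{0..<int 4}. unity_root 4 (j * x) * graph_sum (f x) c k))\<^sup>2 = of_nat (4 * p)"
    unfolding G_def by (rule relative_difference_set_flat_graph) blast
  then show False using exists_non_flat_transform[of f] by auto
qed

end
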